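(* Let $(X,\rho,\mu)$ be a space of homogeneous type (with the standing assumptions listed in the context), $\varepsilon_0:=\delta^{\lfloor\log_\delta 2^{1/p}\rfloor p}/2$, $\gamma\in[0,1/\varepsilon_0)$, and $\omega\in A_1^+(\gamma)$. (i) If $\gamma=0$, then, for any $q\in(1,\infty)$ and $\gamma'\in[0,1)$, $A_1^+(0)\subset A_q^+(\gamma')$. (ii) If $\gamma\ne0$, then, for any $q\in(1,\infty)$ and $\gamma'\in(0,1)$, $A_1^+(\gamma)\subset A_q^+(\gamma')$.
   Context: Setting. $(X,\rho)$ is a quasi-metric space: $\rho:X\times X\to[0,\infty)$, $\rho(x,y)=0$ iff $x=y$, $\rho(x,y)=\rho(y,x)$, and $\rho(x,y)\le K_0[\rho(x,z)+\rho(z,y)]$ for all $x,y,z\in X$, with a constant $K_0\in[1,\infty)$. Balls are $B(x,r)=\{y\in X:\rho(x,y)<r\}$. $\mu$ is a nonnegative measure on a $\sigma$-algebra containing the balls which is doubling: $\mu(B(x,2r))\le C_\mu\mu(B(x,r))$ for all $x\in X$, $r\in(0,\infty)$; then $(X,\rho,\mu)$ is called a space of homogeneous type. Standing assumptions: (a) for each $x$ the balls $\{B(x,r)\}_{r>0}$ form a basis of open neighborhoods of $x$; (b) $\mu$ is Borel regular (open sets are measurable and every $A\subset X$ lies in a Borel set $E$ with $\mu(A)=\mu(E)$); (c) $0<\mu(B(x,r))<\infty$ for all balls; (d) $\operatorname{diam}(X)=\infty$ and $\mu(\{x\})=0$ for all $x$; (e) monotone geodesic property: there is a constant $\widetilde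 K>0$ such that for all $s\in(0,\infty)$ and $x,y\in X$ with $\rho(x,y)\ge s$ there are $m\in\mathbb N$ and points $x_0=x,x_1,\dots,x_m=y$ with $\rho(x_i,x_{i+1})\le\widetilde K s$ and $\rho(x_{i+1},x_m)\le\rho(x_i,x_m)-s$ for $i=0,\dots,m-1$. Fix $p\in(1,\infty)$. $X\times\mathbb R$ carries the quasi-metric $d((x,t),(y,s))=\max\{\rho(x,y),|t-s|^{1/p}\}$ and the product measure $\lambda=\mu\times m$, $m$ being Lebesgue measure on $\mathbb R$; the same basic assumptions (a)-(d) are made for $(X\times\mathbb R,d,\lambda)$. All integrals are with respect to $\lambda$, and $⨍_E f:=\frac1{\lambda(E)}\int_E f$ denotes the average. $\lfloor a\rfloor$ is the largest integer not greater than $a$. Parabolic cylinders. For $x\in X$, $t\in\mathbb R$, $l\in(0,\infty)$, $\gamma\in[0,1)$ put $R=R(x,t,l)=B(x,l)\times(t-l^p,t+l^p)$, $R^-(\gamma)=B(x,l)\times(t-l^p,t-\gamma l^p)$, $R^+(\gamma)=B(x,l)\times(t+\gamma l^p,t+l^p)$. Weights. A weight is a real-valued, $\lambda$-almost everywhere positive, locally integrable function on $X\times\mathbb R$ (integrable on some cylinder $R(x,t,r)$ around each point). For $q\in(1,\infty)$, with $1/q+1/q'=1$, and $\gamma\in[0,1)$, a weight $\omega$ belongs to $A^+_q(\gamma)$ if $\sup_{R}\left[⨍_{R^-(\gamma)}\omega\right]\left[⨍_{R^+(\gamma)}\omega^{1-q'}\right]^{q-1}<\infty$, the supremum being over all parabolic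 cylinders $R(x,t,l)$. Adjacent dyadic systems and parabolic rectangles. Fix $\delta\in(0,1)$ with $96K_0^6\delta\le1$ and constants $0<c_0\le C_0<\infty$ with $12K_0^3C_0\delta\le c_0$; let $c_1=(3K_0^2)^{-1}c_0$, $C_1=2K_0C_0$. Fix (they exist by a theorem of Hytönen and Kairema) $K\in\mathbb N$ and, for $\tau\in\{1,\dots,K\}$, points $\{z^{k,\tau}_\alpha\}$ and families $\mathfrak D^\tau=\{Q^{k,\tau}_\alpha: k\in\mathbb Z,\alpha\in I_{k,\tau}\}$ of subsets of $X$ (dyadic cubes) such that for each $\tau$: $\rho(z^{k,\tau}_\alpha,z^{k,\tau}_\beta)\ge c_0\delta^k$ for $\alpha\ne\beta$ and $\min_\alpha\rho(x,z^{k,\tau}_\alpha)<C_0\delta^k$ for all $x\in X$; if $l\ge k$, then either $Q^{l,\tau}_\beta\subset Q^{k,\tau}_\alpha$ or they are disjoint; for each $k$, $X$ is the disjoint union of $Q^{k,\tau}_\alpha$, $\alpha\in I_{k,\tau}$; $B(z^{k,\tau}_\alpha,c_1\delta^k)\subset Q^{k,\tau}_\alpha\subset B(z^{k,\tau}_\alpha,C_1\delta^k)$; if $l\ge k$ and $Q^{l,\tau}_\beta\subset Q^{k,\tau}_\alpha$, then $B(z^{l,\tau}_\beta,C_1\delta^l)\subset B(z^{k,\tau}_\alpha,C_1\delta^k)$; moreover there is a constant $C_*>0$ such that every ball $B(x,r)$ is contained in some $Q^{k,\tau}_\alpha$ (for some $\tau$) with $\operatorname{diam}(Q^{k,\tau}_\alpha)\le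 C_*r$. A parabolic rectangle is $P=P(\tau,k,\alpha,t)=Q^{k,\tau}_\alpha\times(t-\delta^{kp},t+\delta^{kp})$, with $P^-(\gamma)=Q^{k,\tau}_\alpha\times(t-\delta^{kp},t-\gamma\delta^{kp})$. Maximal function and $A_1^+$. For $f\in L^1_{\rm loc}(X\times\mathbb R)$, $\mathcal M^{\gamma-}f(x,t)=\sup ⨍_{P^-(\gamma)}|f|$, the supremum being over all $\tau,k,\alpha$ with $(x,t)\in P=P(\tau,k,\alpha,t)$ (i.e. $x\in Q^{k,\tau}_\alpha$; the same $t$). For $\gamma\in[0,1)$, a weight $\omega$ belongs to $A_1^+(\gamma)$ if there is a constant $C>0$ with $\mathcal M^{\gamma-}\omega\le C\omega$ $\lambda$-almost everywhere. (Note $\varepsilon_0\ge1$.) *)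

theory Defs
  imports "HOL-Analysis.Analysis"
begin

section \<open>Quasi-metric spaces and spaces of homogeneous type\<close>

text \<open>The underlying set \<open>X\<close> is the type \<open>'a\<close>; the quasi-metric is a plain function.\<close>

definition qball :: "('a \<Rightarrow> 'a \<Rightarrow> real) \<Rightarrow> 'a \<Rightarrow> real \<Rightarrow> 'a set" where
  "qball \<rho> x r = {y. \<rho> x y < r}"

definition qdiam :: "('a \<Rightarrow> 'a \<Rightarrow> real) \<Rightarrow> 'a set \<Rightarrow> ennreal" where
  "qdiam \<rho> A = (SUP x\<in>A. SUP y\<in>A. ennreal (\<rho> x y))"

text \<open>The topology induced by a quasi-metric. Balls of a quasi-metric need not be open in it.\<close>

definition qopen :: "('a \<Rightarrow> 'a \<Rightarrow> real) \<Rightarrow> 'a set \<Rightarrow> bool" where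
  "qopen \<rho> U \<longleftrightarrow> (\<forall>x\<in>U. \<exists>r>0. qball \<rho> x r \<subseteq> U)"

locale quasi_metric =
  fixes \<rho> :: "'a \<Rightarrow> 'a \<Rightarrow> real" and K0 :: real
  assumes K0_ge_1: "1 \<le> K0"
    and nonneg: "0 \<le> \<rho> x y"
    and eq_0_iff: "\<rho> x y = 0 \<longleftrightarrow> x = y"
    and sym: "\<rho> x y = \<rho> y x"
    and quasi_triangle: "\<rho> x y \<le> K0 * (\<rho> x z + \<rho> z y)"

locale homogeneous_type = quasi_metric \<rho> K0
  for \<rho> :: "'a \<Rightarrow> 'a \<Rightarrow> real" and K0 :: real +
  fixes \<mu> :: "'a measure" and C\<^sub>\<mu> :: real
  assumes space_eq: "space \<mu> = UNIV"
    and ball_measurable: "qball \<rho> x r \<in> sets \<mu>"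
    and doubling: "0 < r \<Longrightarrow>
      emeasure \<mu> (qball \<rho> x (2 * r)) \<le> ennreal C\<^sub>\<mu> * emeasure \<mu> (qball \<rho> x r)"

text \<open>The standing assumptions that are made both for \<open>X\<close> and for \<open>X \<times> \<real>\<close>.
  In Borel regularity the measure of an arbitrary set is its outer measure.\<close>

locale basic_assumptions =
  fixes \<rho> :: "'a \<Rightarrow> 'a \<Rightarrow> real" and \<mu> :: "'a measure"
  assumes ball_open: "0 < r \<Longrightarrow> qopen \<rho> (qball \<rho> x r)"
    and ball_basis: "qopen \<rho> U \<Longrightarrow> x \<in> U \<Longrightarrow> \<exists>r>0. qball \<rho> x r \<subseteq> U"
    and open_measurable: "qopen \<rho> U \<Longrightarrow> U \<in> sets \<mu>"
    and borel_regular: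
      "\<exists>E\<in>sigma_sets UNIV {U. qopen \<rho> U}. A \<subseteq> E \<and> outer_measure_of \<mu> A = emeasure \<mu> E"
    and ball_pos: "0 < r \<Longrightarrow> 0 < emeasure \<mu> (qball \<rho> x r)"
    and ball_finite: "0 < r \<Longrightarrow> emeasure \<mu> (qball \<rho> x r) < \<infinity>"
    and diam_infinite: "qdiam \<rho> UNIV = \<infinity>"
    and singleton_null: "emeasure \<mu> {x} = 0"

definition monotone_geodesic :: "('a \<Rightarrow> 'a \<Rightarrow> real) \<Rightarrow> bool" where
  "monotone_geodesic \<rho> \<longleftrightarrow>
    (\<exists>K'>0. \<forall>s>0. \<forall>x y. s \<le> \<rho> x y \<longrightarrow>
      (\<exists>(m::nat) u. u 0 = x \<and> u m = y \<and>
        (\<forall>i<m. \<rho> (u i) (u (Suc i)) \<le> K' * s \<and> \<rho> (u (Suc i)) (u m) \<le> \<rho> (u i) (u m) - s)))"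


section \<open>The parabolic product space\<close>

definition par_dist :: "real \<Rightarrow> ('a \<Rightarrow> 'a \<Rightarrow> real) \<Rightarrow> 'a \<times> real \<Rightarrow> 'a \<times> real \<Rightarrow> real" where
  "par_dist p \<rho> = (\<lambda>(x, t) (y, s). max (\<rho> x y) (\<bar>t - s\<bar> powr (1 / p)))"

text \<open>The completed product measure, so that for instance on \<open>\<real>\<^sup>n \<times> \<real>\<close> one obtains Lebesgue measure
  on all Lebesgue measurable sets; completing before or after taking the product makes no
  difference to the result.\<close>

definition par_measure :: "'a measure \<Rightarrow> ('a \<times> real) measure" where
  "par_measure \<mu> = completion (\<mu> \<Otimes>\<^sub>M lborel)"

definition cylinder :: "real \<Rightarrow> ('a \<Rightarrow> 'a \<Rightarrow> real) \<Rightarrow> 'a \<Rightarrow> real \<Rightarrow> real \<Rightarrow> ('a \<times> real) set" where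
  "cylinder p \<rho> x t l = qball \<rho> x l \<times> {t - l powr p <..< t + l powr p}"

definition cylinder_minus ::
  "real \<Rightarrow> ('a \<Rightarrow> 'a \<Rightarrow> real) \<Rightarrow> real \<Rightarrow> 'a \<Rightarrow> real \<Rightarrow> real \<Rightarrow> ('a \<times> real) set" where
  "cylinder_minus p \<rho> \<gamma> x t l = qball \<rho> x l \<times> {t - l powr p <..< t - \<gamma> * l powr p}"

definition cylinder_plus ::
  "real \<Rightarrow> ('a \<Rightarrow> 'a \<Rightarrow> real) \<Rightarrow> real \<Rightarrow> 'a \<Rightarrow> real \<Rightarrow> real \<Rightarrow> ('a \<times> real) set" where
  "cylinder_plus p \<rho> \<gamma> x t l = qball \<rho> x l \<times> {t + \<gamma> * l powr p <..< t + l powr p}"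

definition par_average :: "'b measure \<Rightarrow> 'b set \<Rightarrow> ('b \<Rightarrow> ennreal) \<Rightarrow> ennreal" where
  "par_average M E f = (\<integral>\<^sup>+z\<in>E. f z \<partial>M) / emeasure M E"

text \<open>Real powers with positive exponent, extended by \<open>\<infinity>\<^sup>a = \<infinity>\<close>.\<close>

definition ennpowr :: "ennreal \<Rightarrow> real \<Rightarrow> ennreal" where
  "ennpowr u a = (if u = \<infinity> then \<infinity> else ennreal (enn2real u powr a))"


section \<open>Weights\<close>

definition weight ::
  "real \<Rightarrow> ('a \<Rightarrow> 'a \<Rightarrow> real) \<Rightarrow> 'a measure \<Rightarrow> ('a \<times> real \<Rightarrow> real) \<Rightarrow> bool" where
  "weight p \<rho> \<mu> \<omega> \<longleftrightarrow>
     \<omega> \<in> borel_measurable (par_measure \<mu>) \<and>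
     (AE z in par_measure \<mu>. 0 < \<omega> z) \<and>
     (\<forall>x t. \<exists>r>0. set_integrable (par_measure \<mu>) (cylinder p \<rho> x t r) \<omega>)"

text \<open>The averages are extended-valued: neither \<open>\<omega>\<close> nor \<open>\<omega>\<^bsup>1 - q'\<^esup>\<close> is a priori integrable on
  every cylinder. The conjugate exponent of \<open>q\<close> is \<open>q' = q / (q - 1)\<close>.\<close>

definition A_plus ::
  "real \<Rightarrow> ('a \<Rightarrow> 'a \<Rightarrow> real) \<Rightarrow> 'a measure \<Rightarrow> real \<Rightarrow> real \<Rightarrow> ('a \<times> real \<Rightarrow> real) set" where
  "A_plus p \<rho> \<mu> q \<gamma> = {\<omega>. weight p \<rho> \<mu> \<omega> \<and>
     (SUP (x, t, l) \<in> UNIV \<times> UNIV \<times> {0<..}.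
        par_average (par_measure \<mu>) (cylinder_minus p \<rho> \<gamma> x t l) (\<lambda>z. ennreal (\<omega> z)) *
        ennpowr (par_average (par_measure \<mu>) (cylinder_plus p \<rho> \<gamma> x t l)
                   (\<lambda>z. ennreal (\<omega> z powr (1 - q / (q - 1))))) (q - 1)) < \<infinity>}"


section \<open>Adjacent dyadic systems\<close>

text \<open>The cubes \<open>Q k \<tau> \<alpha>\<close>, with \<open>\<alpha> \<in> I k \<tau>\<close> and \<open>1 \<le> \<tau> \<le> K\<close>, have reference points
  \<open>z k \<tau> \<alpha>\<close>. That averages over the cubes make sense requires them to be measurable up to null
  sets. (This is in fact automatic under the standing assumptions: by the two-sided ball condition
  and nestedness the boundary of a cube contains no density point of itself, so it is a null set
  for the doubling measure \<open>\<mu>\<close>.)\<close>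

locale adjacent_dyadic_systems =
  fixes \<rho> :: "'a \<Rightarrow> 'a \<Rightarrow> real" and K0 :: real and \<mu> :: "'a measure"
    and \<delta> c\<^sub>0 C\<^sub>0 :: real and K :: nat
    and I :: "int \<Rightarrow> nat \<Rightarrow> 'i set" and z :: "int \<Rightarrow> nat \<Rightarrow> 'i \<Rightarrow> 'a"
    and Q :: "int \<Rightarrow> nat \<Rightarrow> 'i \<Rightarrow> 'a set"
  assumes delta: "0 < \<delta>" "\<delta> < 1" "96 * K0 ^ 6 * \<delta> \<le> 1"
    and constants: "0 < c\<^sub>0" "c\<^sub>0 \<le> C\<^sub>0" "12 * K0 ^ 3 * C\<^sub>0 * \<delta> \<le> c\<^sub>0"
    and separated: "\<lbrakk>\<tau> \<in> {1..K}; \<alpha> \<in> I k \<tau>; \<beta> \<in> I k \<tau>; \<alpha> \<noteq> \<beta>\<rbrakk> \<Longrightarrow>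
      c\<^sub>0 * \<delta> powi k \<le> \<rho> (z k \<tau> \<alpha>) (z k \<tau> \<beta>)"
    and dense: "\<tau> \<in> {1..K} \<Longrightarrow> \<exists>\<alpha>\<in>I k \<tau>. \<rho> x (z k \<tau> \<alpha>) < C\<^sub>0 * \<delta> powi k"
    and nested: "\<lbrakk>\<tau> \<in> {1..K}; k \<le> l; \<alpha> \<in> I k \<tau>; \<beta> \<in> I l \<tau>\<rbrakk> \<Longrightarrow>
      Q l \<tau> \<beta> \<subseteq> Q k \<tau> \<alpha> \<or> Q l \<tau> \<beta> \<inter> Q k \<tau> \<alpha> = {}"
    and cover: "\<tau> \<in> {1..K} \<Longrightarrow> (\<Union>\<alpha>\<in>I k \<tau>. Q k \<tau> \<alpha>) = UNIV"
    and disjoint: "\<tau> \<in> {1..K} \<Longrightarrow> disjoint_family_on (Q k \<tau>) (I k \<tau>)"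
    and inner_ball: "\<lbrakk>\<tau> \<in> {1..K}; \<alpha> \<in> I k \<tau>\<rbrakk> \<Longrightarrow>
      qball \<rho> (z k \<tau> \<alpha>) (c\<^sub>0 / (3 * K0\<^sup>2) * \<delta> powi k) \<subseteq> Q k \<tau> \<alpha>"
    and outer_ball: "\<lbrakk>\<tau> \<in> {1..K}; \<alpha> \<in> I k \<tau>\<rbrakk> \<Longrightarrow>
      Q k \<tau> \<alpha> \<subseteq> qball \<rho> (z k \<tau> \<alpha>) (2 * K0 * C\<^sub>0 * \<delta> powi k)"
    and nested_balls: "\<lbrakk>\<tau> \<in> {1..K}; k \<le> l; \<alpha> \<in> I k \<tau>; \<beta> \<in> I l \<tau>; Q l \<tau> \<beta> \<subseteq> Q k \<tau> \<alpha>\<rbrakk> \<Longrightarrow>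
      qball \<rho> (z l \<tau> \<beta>) (2 * K0 * C\<^sub>0 * \<delta> powi l) \<subseteq> qball \<rho> (z k \<tau> \<alpha>) (2 * K0 * C\<^sub>0 * \<delta> powi k)"
    and adjacent: "\<exists>C>0. \<forall>x r. 0 < r \<longrightarrow>
      (\<exists>\<tau>\<in>{1..K}. \<exists>k. \<exists>\<alpha>\<in>I k \<tau>. qball \<rho> x r \<subseteq> Q k \<tau> \<alpha> \<and> qdiam \<rho> (Q k \<tau> \<alpha>) \<le> ennreal (C * r))"
    and cube_measurable: "\<lbrakk>\<tau> \<in> {1..K}; \<alpha> \<in> I k \<tau>\<rbrakk> \<Longrightarrow> Q k \<tau> \<alpha> \<in> sets (completion \<mu>)"


section \<open>The dyadic parabolic maximal function\<close>

text \<open>The lower part of the parabolic rectangle over a cube \<open>S\<close> of generation \<open>k\<close>; the generation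
  is a separate argument as it is not determined by the set \<open>S\<close>.\<close>

definition rectangle_minus ::
  "real \<Rightarrow> real \<Rightarrow> real \<Rightarrow> int \<Rightarrow> 'a set \<Rightarrow> real \<Rightarrow> ('a \<times> real) set" where
  "rectangle_minus p \<delta> \<gamma> k S t =
     S \<times> {t - \<delta> powr (of_int k * p) <..< t - \<gamma> * \<delta> powr (of_int k * p)}"

definition max_minus ::
  "real \<Rightarrow> 'a measure \<Rightarrow> real \<Rightarrow> nat \<Rightarrow> (int \<Rightarrow> nat \<Rightarrow> 'i set) \<Rightarrow> (int \<Rightarrow> nat \<Rightarrow> 'i \<Rightarrow> 'a set) \<Rightarrow>
   real \<Rightarrow> ('a \<times> real \<Rightarrow> real) \<Rightarrow> 'a \<times> real \<Rightarrow> ennreal" where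
  "max_minus p \<mu> \<delta> K I Q \<gamma> f = (\<lambda>(x, t).
     SUP (\<tau>, k, \<alpha>) \<in> {(\<tau>, k, \<alpha>). \<tau> \<in> {1..K} \<and> \<alpha> \<in> I k \<tau> \<and> x \<in> Q k \<tau> \<alpha>}.
       par_average (par_measure \<mu>) (rectangle_minus p \<delta> \<gamma> k (Q k \<tau> \<alpha>) t) (\<lambda>w. ennreal \<bar>f w\<bar>))"

definition A1_plus ::
  "real \<Rightarrow> ('a \<Rightarrow> 'a \<Rightarrow> real) \<Rightarrow> 'a measure \<Rightarrow> real \<Rightarrow> nat \<Rightarrow> (int \<Rightarrow> nat \<Rightarrow> 'i set) \<Rightarrow>
   (int \<Rightarrow> nat \<Rightarrow> 'i \<Rightarrow> 'a set) \<Rightarrow> real \<Rightarrow> ('a \<times> real \<Rightarrow> real) set" where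
  "A1_plus p \<rho> \<mu> \<delta> K I Q \<gamma> = {\<omega>. weight p \<rho> \<mu> \<omega> \<and>
     (\<exists>C>0. AE w in par_measure \<mu>. max_minus p \<mu> \<delta> K I Q \<gamma> \<omega> w \<le> ennreal (C * \<omega> w))}"

text \<open>Since \<open>\<delta> < 1\<close>, the floor is at most \<open>log \<delta> (2 powr (1 / p)) < 0\<close>, and so
  \<open>\<epsilon>\<^sub>0 \<ge> 1\<close>.\<close>

definition eps0 :: "real \<Rightarrow> real \<Rightarrow> real" where
  "eps0 p \<delta> = \<delta> powr (of_int \<lfloor>log \<delta> (2 powr (1 / p))\<rfloor> * p) / 2"

end

theory Submission
  imports Defs
begin

text \<open>If the average of \<open>\<omega>\<close> over the lower part of every cylinder is bounded by a multiple of \<open>\<omega>\<close> at almost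
  every point of the upper part, then \<open>\<omega>\<close> satisfies \<open>A\<^sub>q\<^sup>+\<close> for every \<open>q\<close>. For \<open>\<gamma> = 0\<close> this bound
  comes from a single parabolic rectangle of a comparable but larger size. For \<open>\<gamma> > 0\<close> the time
  lag of such a rectangle may be too large. Instead, the \<open>A\<^sub>1\<close> condition is iterated at a scale \<open>d\<close>
  much smaller than the size \<open>l\<close> of the cylinder: it is integrated to a comparison of the masses of
  boxes at distance about \<open>d\<close> with a time lag about \<open>d powr p\<close>, and the boxes are chained along
  monotone geodesics. Since \<open>p > 1\<close>, the spatial distance \<open>l\<close> can be covered within any given
  fraction of the time \<open>l powr p\<close>, with a number of steps that depends only on the constants.\<close>

section \<open>Chains and coverings\<close>

context quasi_metric
begin

lemma qball_mono: "r \<le> R \<Longrightarrow> qball \<rho> x r \<subseteq> qball \<rho> x R"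
  by (auto simp: qball_def)

lemma qball_subset_qball:
  assumes "\<rho> x y \<le> d" "K0 * (d + r) \<le> R"
  shows "qball \<rho> y r \<subseteq> qball \<rho> x R"
proof
  fix w assume w: "w \<in> qball \<rho> y r"
  have "\<rho> x w \<le> K0 * (\<rho> x y + \<rho> y w)" by (rule quasi_triangle)
  also have "\<dots> < K0 * (d + r)"
    using w assms K0_ge_1 by (intro mult_strict_left_mono) (auto simp: qball_def)
  finally show "w \<in> qball \<rho> x R" using assms by (auto simp: qball_def)
qed

text \<open>Infinite diameter speaks of pairs. If all points were within \<open>R\<close> of one
  fixed point, the quasi-triangle inequality would bound all distances by
  \<open>K0 * (R + R)\<close>.\<close>

lemma far_point:
  assumes "qdiam \<rho> UNIV = \<infinity>"
  obtains y where "R \<le> \<rho> x y"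
proof (rule ccontr)
  assume "\<not> thesis"
  then have "\<rho> x y < R" for y using that by (meson not_le)
  then have "\<rho> a c \<le> K0 * (R + R)" for a c
    using quasi_triangle[of a c x] K0_ge_1 sym
    by (smt (verit, best) mult_left_mono)
  then have "qdiam \<rho> UNIV \<le> ennreal (K0 * (R + R))"
    unfolding qdiam_def by (intro SUP_least ennreal_leI)
  then show False using assms by (simp add: top_unique)
qed

text \<open>The geodesic property is applied with \<open>s = d / K'\<close>, so that the step length
  \<open>d\<close> becomes the parameter. Taking \<open>K' = max 1 K1\<close> keeps the steps below
  \<open>d\<close> and gives \<open>K' \<ge> 1\<close>.\<close>

lemma monotone_geodesic_steps:
  assumes "monotone_geodesic \<rho>"
  shows "\<exists>K'\<ge>1. \<forall>d x y. 0 < d \<and> d \<le> K' * \<rho> x y \<longrightarrow>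
      (\<exists>(m::nat) u. u 0 = x \<and> u m = y \<and>
        (\<forall>i<m. \<rho> (u i) (u (Suc i)) \<le> d \<and> \<rho> (u (Suc i)) y \<le> \<rho> (u i) y - d / K'))"
proof -
  obtain K1 where K1: "K1 > 0" and "\<forall>s>0. \<forall>x y. s \<le> \<rho> x y \<longrightarrow>
      (\<exists>(m::nat) u. u 0 = x \<and> u m = y \<and>
        (\<forall>i<m. \<rho> (u i) (u (Suc i)) \<le> K1 * s \<and> \<rho> (u (Suc i)) (u m) \<le> \<rho> (u i) (u m) - s))"
    using assms unfolding monotone_geodesic_def by (elim exE conjE)
  then have *: "\<exists>(m::nat) u. u 0 = x \<and> u m = y \<and>
        (\<forall>i<m. \<rho> (u i) (u (Suc i)) \<le> K1 * s \<and> \<rho> (u (Suc i)) (u m) \<le> \<rho> (u i) (u m) - s)"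
    if "0 < s" "s \<le> \<rho> x y" for s x y using that by simp
  define K' where "K' = max 1 K1"
  have K': "K' \<ge> 1" by (simp add: K'_def)
  show ?thesis
  proof (intro exI[of _ K'] conjI K' allI impI; elim conjE)
    fix d x y assume d: "0 < d" "d \<le> K' * \<rho> x y"
    have "K1 \<le> K'" by (simp add: K'_def)
    then have le: "K1 * (d / K') \<le> d" using d K' by (simp add: pos_divide_le_eq mult.commute)
    have "0 < d / K'" "d / K' \<le> \<rho> x y"
      using d K' by (simp_all add: pos_divide_le_eq mult.commute)
    from *[OF this] obtain m :: nat and u where "u 0 = x" "u m = y" "\<forall>i<m. \<rho> (u i) (u (Suc i)) \<le> K1 * (d / K') \<and>
        \<rho> (u (Suc i)) (u m) \<le> \<rho> (u i) (u m) - d / K'"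
      by (elim exE conjE)
    then show "\<exists>(m::nat) u. u 0 = x \<and> u m = y \<and>
        (\<forall>i<m. \<rho> (u i) (u (Suc i)) \<le> d \<and> \<rho> (u (Suc i)) y \<le> \<rho> (u i) y - d / K')"
      using le by (intro exI[of _ m] exI[of _ u]) fastforce
  qed
qed

text \<open>Follow a chain with steps at most \<open>r / (2 * K0)\<close> from a far point to
  \<open>x\<close> and stop at the first point inside the ball. Its predecessor is still outside, so
  the quasi-triangle inequality keeps the stopping point away from \<open>x\<close>. This is what
  bounds the diameter of a dyadic cube from below.\<close>

lemma annulus_nonempty:
  assumes "monotone_geodesic \<rho>" "qdiam \<rho> UNIV = \<infinity>" "0 < r"
  shows "\<exists>y. r / (2 * K0) \<le> \<rho> x y \<and> \<rho> x y < r"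
proof -
  obtain K' where K': "1 \<le> K'" "\<forall>d x y. 0 < d \<and> d \<le> K' * \<rho> x y \<longrightarrow>
      (\<exists>(m::nat) u. u 0 = x \<and> u m = y \<and>
        (\<forall>i<m. \<rho> (u i) (u (Suc i)) \<le> d \<and> \<rho> (u (Suc i)) y \<le> \<rho> (u i) y - d / K'))"
    using monotone_geodesic_steps[OF assms(1)] by (elim exE conjE)
  define d where "d = r / (2 * K0)"
  have d: "0 < d" "d \<le> r" using assms(3) K0_ge_1 by (auto simp: d_def field_simps)
  obtain w where w: "r \<le> \<rho> x w" using far_point[OF assms(2)] .
  have "\<rho> w x \<le> K' * \<rho> w x" using K'(1) nonneg[of w x] by (simp add: mult_le_cancel_right1)
  then have "d \<le> K' * \<rho> w x" using d w sym[of x w] by linarith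
  then obtain m u where u: "u 0 = w" "u m = x" "\<And>i::nat. i < m \<Longrightarrow> \<rho> (u i) (u (Suc i)) \<le> d"
    using K'(2)[rule_format, of d w x] d by blast
  define j where "j = (LEAST i. \<rho> (u i) x < r)"
  have "\<rho> (u m) x < r" using u eq_0_iff[of x x] assms(3) by simp
  then have j: "\<rho> (u j) x < r" and jm: "j \<le> m"
    unfolding j_def by (rule LeastI[of "\<lambda>i. \<rho> (u i) x < r"], rule Least_le)
  have "j \<noteq> 0" using j u(1) w sym[of x w] by (metis not_le)
  then obtain i where i: "j = Suc i" by (metis not0_implies_Suc)
  have "\<not> \<rho> (u i) x < r" using i not_less_Least[of i "\<lambda>i. \<rho> (u i) x < r"] j_def by auto
  moreover have "\<rho> (u i) x \<le> K0 * (\<rho> (u i) (u j) + \<rho> (u j) x)" by (rule quasi_triangle)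
  moreover have "K0 * (\<rho> (u i) (u j) + \<rho> (u j) x) \<le> K0 * (d + \<rho> (u j) x)"
    using u(3)[of i] i jm K0_ge_1 by (intro mult_left_mono) auto
  moreover have "K0 * (d + \<rho> (u j) x) = r / 2 + K0 * \<rho> x (u j)"
    using K0_ge_1 sym[of x "u j"] by (simp add: d_def distrib_left)
  ultimately have "r / 2 \<le> K0 * \<rho> x (u j)" by linarith
  then have "r / (2 * K0) \<le> \<rho> x (u j)" using K0_ge_1 by (simp add: field_simps)
  then show ?thesis using j sym by metis
qed

text \<open>The distance to the endpoint drops by a fixed multiple of \<open>d\<close> in each step of a monotone
  geodesic, which bounds the number of steps; a constant tail then adjusts it to \<open>n\<close>.\<close>

lemma bounded_step_chains:
  assumes "monotone_geodesic \<rho>"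
  shows "\<exists>K'\<ge>1. \<forall>d x y n. 0 < d \<and> 1 + K' * \<rho> x y / d \<le> real n \<longrightarrow>
      (\<exists>u. u 0 = x \<and> u n = y \<and> (\<forall>i<n. \<rho> (u i) (u (Suc i)) \<le> d))"
proof -
  obtain K' where K': "1 \<le> K'" "\<forall>d x y. 0 < d \<and> d \<le> K' * \<rho> x y \<longrightarrow>
      (\<exists>(m::nat) u. u 0 = x \<and> u m = y \<and>
        (\<forall>i<m. \<rho> (u i) (u (Suc i)) \<le> d \<and> \<rho> (u (Suc i)) y \<le> \<rho> (u i) y - d / K'))"
    using monotone_geodesic_steps[OF assms(1)] by (elim exE conjE)
  show ?thesis
  proof (intro exI[of _ K'] conjI K'(1) allI impI; elim conjE)
    fix d x y and n :: nat assume d: "0 < d" "1 + K' * \<rho> x y / d \<le> real n"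
    have "0 \<le> K' * \<rho> x y / d" using d K'(1) nonneg by simp
    then have n: "1 \<le> n" using d by linarith
    obtain m :: nat and u where m: "m \<le> n" and u: "u 0 = x" "u m = y"
      "\<And>i. i < m \<Longrightarrow> \<rho> (u i) (u (Suc i)) \<le> d"
    proof (cases "d \<le> K' * \<rho> x y")
      case True
      then obtain m :: nat and u where u: "u 0 = x" "u m = y"
        "\<And>i. i < m \<Longrightarrow> \<rho> (u i) (u (Suc i)) \<le> d"
        "\<And>i. i < m \<Longrightarrow> \<rho> (u (Suc i)) y \<le> \<rho> (u i) y - d / K'"
        using K'(2)[rule_format, of d x y] d(1) True by blast
      have "i \<le> m \<Longrightarrow> \<rho> (u i) y \<le> \<rho> x y - i * (d / K')" for i
      proof (induction i)
        case (Suc i)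
        then show ?case using u(4)[of i] by (simp add: algebra_simps add_divide_distrib)
      qed (simp add: u)
      from this[of m] have "m * (d / K') \<le> \<rho> x y" using u(2) eq_0_iff[of y y] by simp
      then have "m * d \<le> K' * \<rho> x y" using K'(1) by (simp add: pos_divide_le_eq mult.commute)
      then have "m \<le> K' * \<rho> x y / d" using d(1) by (simp add: pos_le_divide_eq)
      then have "m \<le> n" using d by linarith
      then show thesis using that u by blast
    next
      \<comment> \<open>The geodesic property yields no chain here, but \<open>K' \<ge> 1\<close>
        forces \<open>\<rho> x y \<le> d\<close>, so a single step suffices. The summand 1 in the
        lower bound on \<open>n\<close> leaves room for it.\<close>
      case False
      moreover have "\<rho> x y \<le> K' * \<rho> x y" using K'(1) nonneg[of x y] by (simp add: mult_le_cancel_right1)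
      ultimately have "\<rho> x y \<le> d" by linarith
      then show thesis using that[of 1 "\<lambda>i. if i = 0 then x else y"] n by simp
    qed
    define v where "v i = u (min i m)" for i
    have "v 0 = x" "v n = y" using u m by (simp_all add: v_def min_absorb2)
    moreover have "\<rho> (v i) (v (Suc i)) \<le> d" for i
      using u(3)[of i] d(1) eq_0_iff[of "u m" "u m"] by (cases "i < m") (simp_all add: v_def min_def)
    ultimately show "\<exists>u. u 0 = x \<and> u n = y \<and> (\<forall>i<n. \<rho> (u i) (u (Suc i)) \<le> d)"
      by blast
  qed
qed

end

section \<open>Volume comparison and finite coverings in a doubling space\<close>

locale doubling_space = homogeneous_type \<rho> K0 \<mu> C\<^sub>\<mu> + basic_assumptions \<rho> \<mu>
  for \<rho> :: "'a \<Rightarrow> 'a \<Rightarrow> real" and K0 :: real and \<mu> :: "'a measure" and C\<^sub>\<mu> :: real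
begin

lemma doubling_power:
  assumes "0 < r"
  shows "emeasure \<mu> (qball \<rho> x (2 ^ n * r)) \<le> ennreal (max 1 C\<^sub>\<mu> ^ n) * emeasure \<mu> (qball \<rho> x r)"
proof (induction n)
  case (Suc n)
  have "emeasure \<mu> (qball \<rho> x (2 ^ Suc n * r)) \<le> ennreal C\<^sub>\<mu> * emeasure \<mu> (qball \<rho> x (2 ^ n * r))"
    using doubling[of "2 ^ n * r" x] assms by (simp add: mult.assoc)
  also have "\<dots> \<le> ennreal (max 1 C\<^sub>\<mu>) * (ennreal (max 1 C\<^sub>\<mu> ^ n) * emeasure \<mu> (qball \<rho> x r))"
    by (intro mult_mono Suc ennreal_leI) auto
  finally show ?case by (simp add: ennreal_mult mult.assoc)
qed simp

text \<open>The ball around \<open>y\<close> lies in the ball around \<open>x\<close> of radius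
  \<open>K0 * (A + A) * r\<close>, and finitely many doublings, their number depending on
  \<open>A\<close> and \<open>K0\<close> only, lead back to radius \<open>r\<close>.\<close>

lemma ball_comparison:
  "\<exists>D\<ge>1. \<forall>x y r R. 0 < r \<and> R \<le> A * r \<and> \<rho> x y \<le> A * r \<longrightarrow>
      emeasure \<mu> (qball \<rho> y R) \<le> ennreal D * emeasure \<mu> (qball \<rho> x r)"
proof -
  obtain n where n: "K0 * (A + A) < 2 ^ n" using real_arch_pow[of 2 "K0 * (A + A)"] by auto
  show ?thesis
  proof (intro exI[of _ "max 1 C\<^sub>\<mu> ^ n"] conjI allI impI; (elim conjE)?)
    show "1 \<le> max 1 C\<^sub>\<mu> ^ n" by simp
    fix x y r R assume *: "0 < r" "R \<le> A * r" "\<rho> x y \<le> A * r"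
    have "K0 * (A * r + R) \<le> K0 * (A * r + A * r)"
      using * K0_ge_1 by (intro mult_left_mono) auto
    also have "\<dots> = (K0 * (A + A)) * r" by (simp add: algebra_simps)
    also have "\<dots> \<le> 2 ^ n * r" using n * by (intro mult_right_mono) auto
    finally have "qball \<rho> y R \<subseteq> qball \<rho> x (2 ^ n * r)"
      by (rule qball_subset_qball[OF *(3)])
    then have "emeasure \<mu> (qball \<rho> y R) \<le> emeasure \<mu> (qball \<rho> x (2 ^ n * r))"
      using ball_measurable by (rule emeasure_mono)
    also note doubling_power[OF *(1)]
    finally show "emeasure \<mu> (qball \<rho> y R) \<le> ennreal (max 1 C\<^sub>\<mu> ^ n) * emeasure \<mu> (qball \<rho> x r)" .
  qed
qed

text \<open>A packing argument: the balls of radius \<open>r / (2 * K0)\<close> around the points of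
  \<open>S\<close> are disjoint, lie in one ball around \<open>x\<close>, and each carries at least
  the fraction \<open>1 / D\<close> of its finite positive measure.\<close>

lemma separated_card_bound:
  assumes "0 \<le> A"
  shows "\<exists>M::nat. \<forall>x r S. 0 < r \<and> finite S \<and> S \<subseteq> qball \<rho> x (A * r) \<and>
      (\<forall>v\<in>S. \<forall>w\<in>S. v \<noteq> w \<longrightarrow> r \<le> \<rho> v w) \<longrightarrow> card S \<le> M"
proof -
  \<comment> \<open>\<open>B\<close> is the ratio of the radius \<open>R\<close> of the enclosing
    ball to the radius \<open>r'\<close> of the packed balls.\<close>
  define B where "B = 2 * K0 * (K0 * (A + 1))"
  obtain D where D: "1 \<le> D" "\<forall>x y r R. 0 < r \<and> R \<le> B * r \<and> \<rho> x y \<le> B * r \<longrightarrow>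
      emeasure \<mu> (qball \<rho> y R) \<le> ennreal D * emeasure \<mu> (qball \<rho> x r)"
    using ball_comparison[of B] by (elim exE conjE)
  show ?thesis
  proof (intro exI[of _ "nat \<lfloor>D\<rfloor>"] allI impI; elim conjE)
    fix x r and S :: "'a set"
    assume r: "0 < r" and S: "finite S" "S \<subseteq> qball \<rho> x (A * r)"
      and sep: "\<forall>v\<in>S. \<forall>w\<in>S. v \<noteq> w \<longrightarrow> r \<le> \<rho> v w"
    define r' where "r' = r / (2 * K0)"
    define R where "R = K0 * (A * r + r)"
    have r': "0 < r'" "r' \<le> r" using r K0_ge_1 by (auto simp: r'_def field_simps)
    have RB: "R = B * r'" using K0_ge_1 by (simp add: R_def r'_def B_def field_simps)
    have "A * r \<le> R"
    proof -
      have "1 * (A * r) \<le> K0 * (A * r + r)" using K0_ge_1 r assms by (intro mult_mono) auto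
      then show ?thesis by (simp add: R_def)
    qed
    have R: "0 < R" using r assms K0_ge_1 by (simp add: R_def add_nonneg_pos)
    let ?m = "emeasure \<mu> (qball \<rho> x R)"
    have m: "0 < ?m" "?m < \<infinity>" using ball_pos ball_finite R by auto
    have disj: "disjoint_family_on (\<lambda>w. qball \<rho> w r') S"
      unfolding disjoint_family_on_def
    proof (intro ballI impI equals0I)
      fix v w u assume "v \<in> S" "w \<in> S" "v \<noteq> w" and u: "u \<in> qball \<rho> v r' \<inter> qball \<rho> w r'"
      then have "r \<le> \<rho> v w" using sep by auto
      also have "\<dots> \<le> K0 * (\<rho> v u + \<rho> u w)" by (rule quasi_triangle)
      also have "\<dots> < K0 * (r' + r')" using u K0_ge_1 sym[of u w]
        by (intro mult_strict_left_mono) (auto simp: qball_def)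
      also have "\<dots> = r" using K0_ge_1 by (simp add: r'_def)
      finally show False by simp
    qed
    have "of_nat (card S) * ?m = (\<Sum>w\<in>S. ?m)" by simp
    also have "\<dots> \<le> (\<Sum>w\<in>S. ennreal D * emeasure \<mu> (qball \<rho> w r'))"
    proof (intro sum_mono D(2)[rule_format] conjI r')
      fix w assume "w \<in> S"
      then show "\<rho> w x \<le> B * r'"
        using S(2) \<open>A * r \<le> R\<close> RB sym[of w x] by (force simp: qball_def)
    qed (simp add: RB)
    also have "\<dots> = ennreal D * emeasure \<mu> (\<Union>w\<in>S. qball \<rho> w r')"
      using disj S ball_measurable
      by (subst sum_emeasure[symmetric]) (auto simp: sum_distrib_left)
    also have "\<dots> \<le> ennreal D * ?m"
    proof (intro mult_left_mono emeasure_mono ball_measurable UN_least)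
      fix w assume "w \<in> S"
      then have "\<rho> x w \<le> A * r" using S(2) by (auto simp: qball_def)
      then show "qball \<rho> w r' \<subseteq> qball \<rho> x R"
        by (rule qball_subset_qball) (use r' K0_ge_1 in \<open>auto simp: R_def\<close>)
    qed simp
    finally have "of_nat (card S) \<le> ennreal D"
      using m by (simp add: mult.commute[of _ ?m] ennreal_mult_le_mult_iff)
    then have "real (card S) \<le> D" using D(1) by (simp add: ennreal_of_nat_eq_real_of_nat)
    then show "card S \<le> nat \<lfloor>D\<rfloor>" by linarith
  qed
qed

text \<open>An \<open>r\<close>-separated subset of largest cardinality, which exists by the packing
  bound, is an \<open>r\<close>-net: an uncovered point could be added to it.\<close>

lemma finite_ball_cover:
  assumes "0 \<le> A"
  shows "\<exists>M::nat. \<forall>x r. 0 < r \<longrightarrow> (\<exists>S. finite S \<and> card S \<le> M \<and> S \<subseteq> qball \<rho> x (A * r) \<and>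
      qball \<rho> x (A * r) \<subseteq> (\<Union>w\<in>S. qball \<rho> w r))"
proof -
  obtain M :: nat where M: "\<forall>x r S. 0 < r \<and> finite S \<and> S \<subseteq> qball \<rho> x (A * r) \<and>
      (\<forall>v\<in>S. \<forall>w\<in>S. v \<noteq> w \<longrightarrow> r \<le> \<rho> v w) \<longrightarrow> card S \<le> M"
    using separated_card_bound[OF assms] by (elim exE)
  show ?thesis
  proof (intro exI[of _ M] allI impI)
    fix x r assume r: "(0::real) < r"
    define P where "P S \<longleftrightarrow> finite S \<and> S \<subseteq> qball \<rho> x (A * r) \<and>
      (\<forall>v\<in>S. \<forall>w\<in>S. v \<noteq> w \<longrightarrow> r \<le> \<rho> v w)" for S
    have "P {}" by (simp add: P_def)
    moreover have bound: "P S \<Longrightarrow> card S \<le> M" for S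
      using M[rule_format, of r S x] r unfolding P_def by blast
    ultimately obtain S where S: "P S" and max: "\<And>T. P T \<Longrightarrow> card T \<le> card S"
      using ex_has_greatest_nat[of P "{}" card M] by (metis le_less less_Suc_eq_le)
    have "qball \<rho> x (A * r) \<subseteq> (\<Union>w\<in>S. qball \<rho> w r)"
    proof
      fix y assume y: "y \<in> qball \<rho> x (A * r)"
      show "y \<in> (\<Union>w\<in>S. qball \<rho> w r)"
      proof (rule ccontr)
        assume "y \<notin> (\<Union>w\<in>S. qball \<rho> w r)"
        then have far: "\<forall>w\<in>S. r \<le> \<rho> w y" by (auto simp: qball_def not_less)
        then have "y \<notin> S" using r eq_0_iff[of y y] by force
        moreover have "\<forall>w\<in>S. r \<le> \<rho> y w" using far sym[of y] by simp
        then have "P (insert y S)" using S y far unfolding P_def by simp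
        ultimately show False using max[of "insert y S"] S by (simp add: P_def)
      qed
    qed
    then show "\<exists>S. finite S \<and> card S \<le> M \<and> S \<subseteq> qball \<rho> x (A * r) \<and>
      qball \<rho> x (A * r) \<subseteq> (\<Union>w\<in>S. qball \<rho> w r)"
      using S bound[OF S] unfolding P_def by (intro exI[of _ S]) simp
  qed
qed

end

section \<open>From one-sided averages to \<open>A\<^sub>q\<^sup>+\<close>\<close>

lemma par_measure_Times [measurable (raw), simp]:
  assumes "A \<in> sets \<mu>" "B \<in> sets borel"
  shows "A \<times> B \<in> sets (par_measure \<mu>)"
  using assms unfolding par_measure_def by auto

lemma emeasure_par_measure_Times:
  assumes "A \<in> sets \<mu>" "B \<in> sets borel"
  shows "emeasure (par_measure \<mu>) (A \<times> B) = emeasure \<mu> A * emeasure lborel B"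
  using assms unfolding par_measure_def by (simp add: lborel.emeasure_pair_measure_Times)

text \<open>The set \<open>E\<close> need not be measurable: otherwise its \<open>emeasure\<close> is the junk value 0, and the
  average is \<open>\<infinity>\<close> unless the integral vanishes.\<close>

lemma nn_integral_le_average:
  assumes "par_average M E f \<le> c" "G \<subseteq> E" "E \<subseteq> F" "F \<in> sets M"
    and "0 < emeasure M F" "emeasure M F < \<infinity>"
  shows "(\<integral>\<^sup>+z\<in>G. f z \<partial>M) \<le> c * emeasure M F"
proof -
  have "(\<integral>\<^sup>+z\<in>G. f z \<partial>M) \<le> (\<integral>\<^sup>+z\<in>E. f z \<partial>M)"
    using assms(2) by (intro nn_integral_mono) (auto split: split_indicator)
  also have "\<dots> \<le> par_average M E f * emeasure M F"
  proof (cases "emeasure M E = 0")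
    case True
    then show ?thesis using assms(5) unfolding par_average_def
      by (cases "(\<integral>\<^sup>+z\<in>E. f z \<partial>M) = 0") (auto simp: divide_ennreal_def ennreal_mult_top ennreal_top_mult)
  next
    case False
    have le: "emeasure M E \<le> emeasure M F" using assms(3,4) by (rule emeasure_mono)
    then have "emeasure M E < top" using assms(6) by (auto intro: le_less_trans)
    with False have "(\<integral>\<^sup>+z\<in>E. f z \<partial>M) = par_average M E f * emeasure M E"
      unfolding par_average_def by (simp add: ennreal_divide_times ennreal_mult_divide_eq)
    also have "\<dots> \<le> par_average M E f * emeasure M F" using le by (rule mult_left_mono) simp
    finally show ?thesis .
  qed
  also have "\<dots> \<le> c * emeasure M F" using assms(1) by (intro mult_right_mono) auto
  finally show ?thesis .
qed

lemma nn_integral_le_finite_cover: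
  assumes "finite F" "R \<subseteq> (\<Union>i\<in>F. E i)" "\<And>i. i \<in> F \<Longrightarrow> E i \<in> sets M"
    and [measurable]: "f \<in> borel_measurable M" and "\<And>i. i \<in> F \<Longrightarrow> (\<integral>\<^sup>+z\<in>E i. f z \<partial>M) \<le> c"
  shows "(\<integral>\<^sup>+z\<in>R. f z \<partial>M) \<le> of_nat (card F) * c"
proof -
  note [measurable] = assms(3)
  have "(\<integral>\<^sup>+z\<in>R. f z \<partial>M) \<le> (\<integral>\<^sup>+z. (\<Sum>i\<in>F. f z * indicator (E i) z) \<partial>M)"
  proof (intro nn_integral_mono)
    fix z show "f z * indicator R z \<le> (\<Sum>i\<in>F. f z * indicator (E i) z)"
    proof (cases "z \<in> R")
      case True
      then obtain i where i: "i \<in> F" "z \<in> E i" using assms(2) by blast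
      have "f z * indicator R z = f z * indicator (E i) z" using i True by simp
      also have "\<dots> \<le> (\<Sum>i\<in>F. f z * indicator (E i) z)"
        using i assms(1) by (intro member_le_sum) auto
      finally show ?thesis .
    qed simp
  qed
  also have "\<dots> = (\<Sum>i\<in>F. \<integral>\<^sup>+z\<in>E i. f z \<partial>M)" by (intro nn_integral_sum) measurable
  also have "\<dots> \<le> (\<Sum>i\<in>F. c)" by (intro sum_mono assms(5))
  finally show ?thesis by simp
qed

lemma ennpowr_le:
  assumes "u \<le> ennreal x" "0 \<le> x" "0 \<le> a"
  shows "ennpowr u a \<le> ennreal (x powr a)"
  using assms unfolding ennpowr_def
  by (cases u rule: ennreal_cases) (auto simp: top_unique intro!: ennreal_leI powr_mono2)

text \<open>The one-sided \<open>A\<^sub>1\<close> condition bounds \<open>\<omega>\<close> from below by a constant on the upper part, which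
  turns into an upper bound of its negative powers.\<close>

lemma A_plus_product_le:
  assumes [measurable]: "E \<in> sets M" and E: "0 < emeasure M E" "emeasure M E < \<infinity>"
    and ae: "AE w in M. w \<in> E \<longrightarrow> A \<le> ennreal (C * \<omega> w)" and C: "0 < C" and q: "1 < q"
  shows "A * ennpowr (par_average M E (\<lambda>z. ennreal (\<omega> z powr (1 - q / (q - 1))))) (q - 1) \<le> ennreal C"
proof -
  \<comment> \<open>Since \<open>E\<close> is not a null set, the almost everywhere bound holds at
    some point of \<open>E\<close>. Hence \<open>A\<close> is finite.\<close>
  have "\<exists>w\<in>E. A \<le> ennreal (C * \<omega> w)"
  proof (rule ccontr)
    assume "\<not> ?thesis"
    then have "AE w in M. w \<notin> E" using ae by (auto elim!: eventually_mono)
    then have "emeasure M {w \<in> space M. w \<in> E} = 0" by (rule emeasure_eq_0_AE)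
    moreover have "{w \<in> space M. w \<in> E} = E" using sets.sets_into_space[OF assms(1)] by blast
    ultimately show False using E by simp
  qed
  then obtain a where a: "A = ennreal a" "0 \<le> a"
    by (metis ennreal_cases ennreal_less_top not_le)
  show ?thesis
  proof (cases "a = 0")
    case False
    define e where "e = 1 - q / (q - 1)"
    \<comment> \<open>The exponent is negative, so the lower bound \<open>a / C\<close> of
      \<open>\<omega>\<close> becomes an upper bound of its power, and the outer exponent
      \<open>q - 1\<close> turns this into \<open>C / a\<close>. In the case \<open>a = 0\<close>
      the product vanishes even if the other factor is infinite.\<close>
    have e: "e = - 1 / (q - 1)" using q by (simp add: e_def field_simps)
    have "(\<integral>\<^sup>+z\<in>E. ennreal (\<omega> z powr e) \<partial>M) \<le> (\<integral>\<^sup>+z\<in>E. ennreal ((a / C) powr e) \<partial>M)"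
    proof (rule nn_integral_mono_AE)
      from ae show "AE z in M. ennreal (\<omega> z powr e) * indicator E z \<le> ennreal ((a / C) powr e) * indicator E z"
      proof eventually_elim
        fix z assume "z \<in> E \<longrightarrow> A \<le> ennreal (C * \<omega> z)"
        then have "a / C \<le> \<omega> z" if "z \<in> E"
          using that a False C by (simp add: ennreal_le_iff2 field_simps)
        then have "\<omega> z powr e \<le> (a / C) powr e" if "z \<in> E"
          using that a False C q by (intro powr_mono2') (auto simp: e)
        then show "ennreal (\<omega> z powr e) * indicator E z \<le> ennreal ((a / C) powr e) * indicator E z"
          by (auto split: split_indicator intro: ennreal_leI)
      qed
    qed
    also have "\<dots> = emeasure M E * ennreal ((a / C) powr e)"
      by (subst nn_integral_cmult_indicator) (simp_all add: mult.commute)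
    finally have "par_average M E (\<lambda>z. ennreal (\<omega> z powr e)) \<le> ennreal ((a / C) powr e)"
      unfolding par_average_def by (rule divide_le_posI_ennreal[OF E(1)])
    then have "ennpowr (par_average M E (\<lambda>z. ennreal (\<omega> z powr e))) (q - 1) \<le> ennreal (((a / C) powr e) powr (q - 1))"
      using q by (intro ennpowr_le) auto
    also have "((a / C) powr e) powr (q - 1) = (a / C) powr - 1"
      using q by (simp add: powr_powr e)
    also have "\<dots> = C / a" using a False C by (simp add: powr_minus_divide)
    finally have "A * ennpowr (par_average M E (\<lambda>z. ennreal (\<omega> z powr e))) (q - 1) \<le> ennreal a * ennreal (C / a)"
      unfolding a(1) by (intro mult_left_mono) auto
    also have "\<dots> = ennreal C" using a(2) False C by (simp add: ennreal_mult[symmetric])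
    finally show ?thesis by (simp add: e_def)
  qed (simp add: a)
qed

context doubling_space
begin

lemma emeasure_ball_box:
  "emeasure (par_measure \<mu>) (qball \<rho> x r \<times> {a<..<b}) = emeasure \<mu> (qball \<rho> x r) * emeasure lborel {a<..<b}"
  by (intro emeasure_par_measure_Times ball_measurable) simp

lemma ball_box_pos_finite:
  assumes "0 < r" "a < b"
  shows "0 < emeasure (par_measure \<mu>) (qball \<rho> x r \<times> {a<..<b})"
    "emeasure (par_measure \<mu>) (qball \<rho> x r \<times> {a<..<b}) < \<infinity>"
  using assms ball_pos[of r x] ball_finite[of r x]
  by (auto simp: emeasure_ball_box ennreal_zero_less_mult_iff ennreal_mult_less_top)

text \<open>The \<open>A\<^sub>1\<close> condition at a single scale. Replacing the dyadic cubes by balls requires a second,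
  larger radius \<open>R\<close> on the right.\<close>

definition backward_bound ::
  "('a \<times> real \<Rightarrow> real) \<Rightarrow> real \<Rightarrow> real \<Rightarrow> real \<Rightarrow> real \<Rightarrow> real \<Rightarrow> 'a \<times> real \<Rightarrow> bool" where
  "backward_bound \<omega> \<gamma> B h R r w \<longleftrightarrow> (\<forall>x. \<rho> x (fst w) < r \<longrightarrow>
    (\<integral>\<^sup>+v\<in>qball \<rho> x r \<times> {snd w - h<..<snd w - \<gamma> * h}. ennreal (\<omega> v) \<partial>par_measure \<mu>)
      \<le> ennreal (B * h) * emeasure \<mu> (qball \<rho> x R) * ennreal (\<omega> w))"

text \<open>For each cylinder the average over the lower part serves as the constant
  \<open>A\<close> of \<open>A_plus_product_le\<close>. The upper part has positive finite measure
  because \<open>\<gamma> < 1\<close>, and \<open>C\<close> bounds all the products at once.\<close>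

lemma A_plus_criterion:
  assumes "weight p \<rho> \<mu> \<omega>" "1 < q" "0 \<le> \<gamma>" "\<gamma> < 1" "0 < C"
    and "\<forall>x t l. 0 < l \<longrightarrow> (AE w in par_measure \<mu>. w \<in> cylinder_plus p \<rho> \<gamma> x t l \<longrightarrow>
      par_average (par_measure \<mu>) (cylinder_minus p \<rho> \<gamma> x t l) (\<lambda>z. ennreal (\<omega> z)) \<le> ennreal (C * \<omega> w))"
  shows "\<omega> \<in> A_plus p \<rho> \<mu> q \<gamma>"
proof -
  have "(SUP (x, t, l) \<in> UNIV \<times> UNIV \<times> {0<..}.
        par_average (par_measure \<mu>) (cylinder_minus p \<rho> \<gamma> x t l) (\<lambda>z. ennreal (\<omega> z)) *
        ennpowr (par_average (par_measure \<mu>) (cylinder_plus p \<rho> \<gamma> x t l)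
                   (\<lambda>z. ennreal (\<omega> z powr (1 - q / (q - 1))))) (q - 1)) \<le> ennreal C"
  proof (rule SUP_least, elim SigmaE, hypsubst, unfold prod.case)
    fix x and t l :: real assume l: "l \<in> {0<..}"
    then have "t + \<gamma> * l powr p < t + l powr p"
      using mult_strict_right_mono[OF assms(4), of "l powr p"] by simp
    then show "par_average (par_measure \<mu>) (cylinder_minus p \<rho> \<gamma> x t l) (\<lambda>z. ennreal (\<omega> z)) *
        ennpowr (par_average (par_measure \<mu>) (cylinder_plus p \<rho> \<gamma> x t l)
                   (\<lambda>z. ennreal (\<omega> z powr (1 - q / (q - 1))))) (q - 1) \<le> ennreal C"
      using l assms(2,5,6) unfolding cylinder_plus_def
      by (intro A_plus_product_le ball_box_pos_finite par_measure_Times ball_measurable) (auto simp: cylinder_plus_def)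
  qed
  also have "\<dots> < \<infinity>" by simp
  finally show ?thesis using assms(1) unfolding A_plus_def by simp
qed

end


section \<open>The \<open>A\<^sub>1\<^sup>+\<close> condition on balls\<close>

locale dyadic_space = doubling_space \<rho> K0 \<mu> C\<^sub>\<mu> + adjacent_dyadic_systems \<rho> K0 \<mu> \<delta> c\<^sub>0 C\<^sub>0 K I z Q
  for \<rho> :: "'a \<Rightarrow> 'a \<Rightarrow> real" and K0 :: real and \<mu> :: "'a measure" and C\<^sub>\<mu> :: real
    and \<delta> c\<^sub>0 C\<^sub>0 :: real and K :: nat
    and I :: "int \<Rightarrow> nat \<Rightarrow> 'i set" and z :: "int \<Rightarrow> nat \<Rightarrow> 'i \<Rightarrow> 'a"
    and Q :: "int \<Rightarrow> nat \<Rightarrow> 'i \<Rightarrow> 'a set" +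
  assumes geodesic: "monotone_geodesic \<rho>"
begin

lemma powi_delta_le_iff: "\<delta> powi k \<le> \<delta> powi l \<longleftrightarrow> l \<le> k"
proof -
  have "\<delta> powi m = \<delta> powr m" for m using delta by (simp add: powr_real_of_int')
  then have "\<delta> powi k \<le> \<delta> powi l \<longleftrightarrow> of_int k * ln \<delta> \<le> of_int l * ln \<delta>"
    using delta by (simp add: powr_def)
  then show ?thesis using delta by (simp add: mult_le_cancel_right)
qed

lemma powi_delta_powr: "(\<delta> powi k) powr p = \<delta> powr (of_int k * p)"
proof -
  have "\<delta> powi k = \<delta> powr k" using delta by (simp add: powr_real_of_int')
  then show ?thesis by (simp add: powr_powr)
qed

text \<open>The scales form a geometric progression with ratio \<open>\<delta>\<close>; rounding the
  logarithm up makes the power smaller, by at most one factor \<open>\<delta>\<close>.\<close>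

lemma ex_scale:
  assumes "0 < t"
  shows "\<exists>k. \<delta> powi k \<le> t \<and> t \<le> \<delta> powi k / \<delta>"
proof -
  define k where "k = \<lceil>log \<delta> t\<rceil>"
  have t: "t = \<delta> powr (log \<delta> t)" using assms delta by simp
  have "log \<delta> t \<le> k" "real_of_int k - 1 \<le> log \<delta> t" unfolding k_def by linarith+
  then have "\<delta> powr k \<le> \<delta> powr (log \<delta> t)" "\<delta> powr (log \<delta> t) \<le> \<delta> powr (real_of_int k - 1)"
    using delta by (auto intro: powr_mono')
  moreover have "\<delta> powr (real_of_int k - 1) = \<delta> powr k / \<delta>" using delta by (simp add: powr_diff)
  moreover have "\<delta> powi k = \<delta> powr k" using delta by (simp add: powr_real_of_int')
  ultimately show ?thesis using t by (intro exI[of _ k]) simp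
qed

text \<open>A cube of small diameter containing the ball has a generation of at least \<open>k\<close>, because the
  annulus in its inner ball is nonempty; then pass to its ancestor.\<close>

lemma ball_subset_cube:
  "\<exists>b>0. \<forall>x r k. 0 < r \<and> b * r \<le> \<delta> powi k \<longrightarrow> (\<exists>\<tau>\<in>{1..K}. \<exists>\<alpha>\<in>I k \<tau>. qball \<rho> x r \<subseteq> Q k \<tau> \<alpha>)"
proof -
  obtain C where C: "C > 0" "\<forall>x r. 0 < r \<longrightarrow>
      (\<exists>\<tau>\<in>{1..K}. \<exists>k. \<exists>\<alpha>\<in>I k \<tau>. qball \<rho> x r \<subseteq> Q k \<tau> \<alpha> \<and> qdiam \<rho> (Q k \<tau> \<alpha>) \<le> ennreal (C * r))"
    using adjacent by (elim exE conjE)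
  define c where "c = c\<^sub>0 / (3 * K0\<^sup>2)"
  have c: "c > 0" using constants K0_ge_1 by (simp add: c_def)
  \<comment> \<open>This solves \<open>c * \<delta> powi l / (2 * K0) \<le> C * r\<close>, the
    comparison of the annulus with the diameter, for \<open>\<delta> powi l\<close>.\<close>
  define b where "b = 2 * K0 * C / c"
  show ?thesis
  proof (intro exI[of _ b] conjI allI impI; (elim conjE)?)
    show "0 < b" using C(1) c K0_ge_1 by (simp add: b_def)
    fix x r k assume r: "0 < r" "b * r \<le> \<delta> powi k"
    obtain \<tau> l \<beta> where Ql: "\<tau> \<in> {1..K}" "\<beta> \<in> I l \<tau>" "qball \<rho> x r \<subseteq> Q l \<tau> \<beta>" "qdiam \<rho> (Q l \<tau> \<beta>) \<le> ennreal (C * r)"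
      using C(2)[rule_format, OF r(1), of x] by (elim bexE exE conjE)
    have d: "0 < c * \<delta> powi l" using c delta by simp
    obtain y where y: "c * \<delta> powi l / (2 * K0) \<le> \<rho> (z l \<tau> \<beta>) y" "\<rho> (z l \<tau> \<beta>) y < c * \<delta> powi l"
      using annulus_nonempty[OF geodesic diam_infinite d] by blast
    have "qball \<rho> (z l \<tau> \<beta>) (c * \<delta> powi l) \<subseteq> Q l \<tau> \<beta>" using inner_ball[OF Ql(1,2)] by (simp add: c_def)
    moreover have "z l \<tau> \<beta> \<in> qball \<rho> (z l \<tau> \<beta>) (c * \<delta> powi l)" "y \<in> qball \<rho> (z l \<tau> \<beta>) (c * \<delta> powi l)"
      using d y(2) eq_0_iff[of "z l \<tau> \<beta>" "z l \<tau> \<beta>"] by (simp_all add: qball_def)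
    ultimately have "ennreal (\<rho> (z l \<tau> \<beta>) y) \<le> qdiam \<rho> (Q l \<tau> \<beta>)"
      unfolding qdiam_def by (intro SUP_upper2[of "z l \<tau> \<beta>"] SUP_upper2[of y]) auto
    then have "ennreal (\<rho> (z l \<tau> \<beta>) y) \<le> ennreal (C * r)" using Ql(4) by (rule order.trans)
    then have "\<rho> (z l \<tau> \<beta>) y \<le> C * r" using C(1) r(1) by simp
    then have "c * \<delta> powi l / (2 * K0) \<le> C * r" using y(1) by linarith
    then have "c * \<delta> powi l \<le> 2 * K0 * (C * r)" using K0_ge_1 by (simp add: pos_divide_le_eq mult.commute)
    then have "\<delta> powi l \<le> b * r" using c by (simp add: b_def field_simps)
    then have kl: "k \<le> l" using r(2) powi_delta_le_iff[of l k] by linarith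
    obtain \<alpha> where \<alpha>: "\<alpha> \<in> I k \<tau>" "x \<in> Q k \<tau> \<alpha>" using cover[OF Ql(1), of k] by blast
    have "x \<in> Q l \<tau> \<beta>" using Ql(3) r(1) eq_0_iff[of x x] by (auto simp: qball_def)
    then have "Q l \<tau> \<beta> \<subseteq> Q k \<tau> \<alpha>" using nested[OF Ql(1) kl \<alpha>(1) Ql(2)] \<alpha>(2) by blast
    then show "\<exists>\<tau>\<in>{1..K}. \<exists>\<alpha>\<in>I k \<tau>. qball \<rho> x r \<subseteq> Q k \<tau> \<alpha>"
      using Ql(1,3) \<alpha>(1) by blast
  qed
qed

text \<open>The small ball lies in a cube of generation \<open>k\<close>, and this cube lies in the
  ball of radius \<open>b * \<delta> powi k\<close> with the same centre. One null set serves all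
  \<open>k\<close>, \<open>r\<close> and all centres, because the maximal function is a supremum
  over all cubes.\<close>

lemma A1_plus_on_balls:
  assumes \<omega>: "\<omega> \<in> A1_plus p \<rho> \<mu> \<delta> K I Q \<gamma>" and \<gamma>: "0 \<le> \<gamma>" "\<gamma> < 1"
  shows "\<exists>b\<ge>1. \<exists>C>0. AE w in par_measure \<mu>. \<forall>k r. 0 < r \<and> b * r \<le> \<delta> powi k \<longrightarrow>
    backward_bound \<omega> \<gamma> C ((\<delta> powi k) powr p) (b * \<delta> powi k) r w"
proof -
  obtain b0 where b0: "b0 > 0" "\<forall>x r k. 0 < r \<and> b0 * r \<le> \<delta> powi k \<longrightarrow> (\<exists>\<tau>\<in>{1..K}. \<exists>\<alpha>\<in>I k \<tau>. qball \<rho> x r \<subseteq> Q k \<tau> \<alpha>)"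
    using ball_subset_cube by (elim exE conjE)
  obtain C where C: "C > 0" "AE w in par_measure \<mu>. max_minus p \<mu> \<delta> K I Q \<gamma> \<omega> w \<le> ennreal (C * \<omega> w)"
    using \<omega> unfolding A1_plus_def by blast
  define C1 where "C1 = 2 * K0 * C\<^sub>0"
  \<comment> \<open>\<open>b0\<close> provides a cube around the small ball;
    \<open>K0 * (C1 + C1)\<close> lets the ball of radius \<open>b * d\<close> around any point of
    the cube contain the whole cube.\<close>
  define b where "b = max (max 1 b0) (K0 * (C1 + C1))"
  have b: "b \<ge> 1" "b0 \<le> b" "K0 * (C1 + C1) \<le> b" by (simp_all add: b_def)
  have "AE w in par_measure \<mu>. \<forall>k r. 0 < r \<and> b * r \<le> \<delta> powi k \<longrightarrow>
    backward_bound \<omega> \<gamma> C ((\<delta> powi k) powr p) (b * \<delta> powi k) r w"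
    using C(2)
  proof (eventually_elim, unfold backward_bound_def, intro allI impI, elim conjE)
    fix w k r x
    assume max: "max_minus p \<mu> \<delta> K I Q \<gamma> \<omega> w \<le> ennreal (C * \<omega> w)"
      and r: "0 < r" "b * r \<le> \<delta> powi k" and w: "\<rho> x (fst w) < r"
    define d where "d = \<delta> powi k"
    define J where "J = {snd w - d powr p <..< snd w - \<gamma> * d powr p}"
    have d: "d > 0" using delta by (simp add: d_def)
    have "b0 * r \<le> b * r" using b r(1) by (intro mult_right_mono) auto
    then have "b0 * r \<le> \<delta> powi k" using r(2) by linarith
    then obtain \<tau> \<alpha> where \<tau>: "\<tau> \<in> {1..K}" and \<alpha>: "\<alpha> \<in> I k \<tau>" and sub: "qball \<rho> x r \<subseteq> Q k \<tau> \<alpha>"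
      using b0(2) r by blast
    have "fst w \<in> Q k \<tau> \<alpha>" using sub w by (auto simp: qball_def)
    then have "par_average (par_measure \<mu>) (rectangle_minus p \<delta> \<gamma> k (Q k \<tau> \<alpha>) (snd w)) (\<lambda>w. ennreal \<bar>\<omega> w\<bar>)
        \<le> max_minus p \<mu> \<delta> K I Q \<gamma> \<omega> w"
      unfolding max_minus_def split_beta using \<tau> \<alpha> by (intro SUP_upper2[of "(\<tau>, k, \<alpha>)"]) auto
    also note max
    also have "rectangle_minus p \<delta> \<gamma> k (Q k \<tau> \<alpha>) (snd w) = Q k \<tau> \<alpha> \<times> J"
      by (simp add: rectangle_minus_def J_def d_def powi_delta_powr)
    finally have avg: "par_average (par_measure \<mu>) (Q k \<tau> \<alpha> \<times> J) (\<lambda>w. ennreal \<bar>\<omega> w\<bar>) \<le> ennreal (C * \<omega> w)" .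
    have outer: "Q k \<tau> \<alpha> \<subseteq> qball \<rho> (z k \<tau> \<alpha>) (C1 * d)"
      using outer_ball[OF \<tau> \<alpha>] by (simp add: C1_def d_def)
    have "x \<in> qball \<rho> x r" using r eq_0_iff[of x x] by (simp add: qball_def)
    then have "x \<in> qball \<rho> (z k \<tau> \<alpha>) (C1 * d)" using sub outer by blast
    then have "\<rho> x (z k \<tau> \<alpha>) \<le> C1 * d" using sym[of x "z k \<tau> \<alpha>"] by (simp add: qball_def)
    moreover have "K0 * (C1 * d + C1 * d) \<le> b * d"
      using mult_right_mono[OF b(3), of d] d by (simp add: algebra_simps)
    ultimately have "qball \<rho> (z k \<tau> \<alpha>) (C1 * d) \<subseteq> qball \<rho> x (b * d)" by (rule qball_subset_qball)
    with outer have outer: "Q k \<tau> \<alpha> \<subseteq> qball \<rho> x (b * d)" by blast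
    have h: "\<gamma> * d powr p < d powr p"
      using mult_strict_right_mono[OF \<gamma>(2), of "d powr p"] d by simp
    have bd: "0 < b * d" using b d by simp
    have "(\<integral>\<^sup>+v\<in>qball \<rho> x r \<times> J. ennreal (\<omega> v) \<partial>par_measure \<mu>) \<le>
      (\<integral>\<^sup>+v\<in>qball \<rho> x r \<times> J. ennreal \<bar>\<omega> v\<bar> \<partial>par_measure \<mu>)"
      by (intro nn_integral_mono mult_right_mono ennreal_leI) auto
    \<comment> \<open>The average over the rectangle is multiplied by the measure of an enclosing
      ball box, whose volume doubling can compare with that of smaller balls.\<close>
    also have "\<dots> \<le> ennreal (C * \<omega> w) * emeasure (par_measure \<mu>) (qball \<rho> x (b * d) \<times> J)"
      using sub outer h bd unfolding J_def
      by (intro nn_integral_le_average[OF avg[unfolded J_def]] par_measure_Times ball_box_pos_finite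
          ball_measurable Sigma_mono) auto
    also have "\<dots> = ennreal (C * \<omega> w) * (emeasure \<mu> (qball \<rho> x (b * d)) * ennreal (d powr p - \<gamma> * d powr p))"
      using h by (simp add: emeasure_ball_box J_def)
    also have "\<dots> \<le> ennreal (C * \<omega> w) * (emeasure \<mu> (qball \<rho> x (b * d)) * ennreal (d powr p))"
      using \<gamma>(1) by (intro mult_left_mono ennreal_leI) auto
    also have "\<dots> = ennreal (C * d powr p) * emeasure \<mu> (qball \<rho> x (b * d)) * ennreal (\<omega> w)"
      using C(1) by (simp add: ennreal_mult' mult_ac)
    finally show "(\<integral>\<^sup>+v\<in>qball \<rho> x r \<times> {snd w - (\<delta> powi k) powr p <..< snd w - \<gamma> * (\<delta> powi k) powr p}. ennreal (\<omega> v) \<partial>par_measure \<mu>)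
    \<le> ennreal (C * (\<delta> powi k) powr p) * emeasure \<mu> (qball \<rho> x (b * \<delta> powi k)) * ennreal (\<omega> w)"
      by (simp add: J_def d_def)
  qed
  then show ?thesis using b(1) C(1) by blast
qed

end

section \<open>Chaining boxes\<close>

text \<open>A total time \<open>\<Lambda>\<close> is to be split into \<open>n\<close> equal lags
  inside the window from \<open>a * h\<close> to \<open>b * h\<close>, so \<open>n\<close> must lie
  between \<open>X / b\<close> and \<open>X / a\<close>. The first lower bound on
  \<open>\<Lambda> / h\<close> gives this interval length at least 1, and its left end is rounded
  up. Since \<open>b < 1\<close> and \<open>a \<ge> 1 / 4\<close>, such an \<open>n\<close> is at
  least \<open>N\<close> and at most \<open>4 * X\<close>.\<close>

lemma choose_steps:
  fixes h \<gamma> N \<Lambda> :: real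
  assumes "0 < h" "0 \<le> \<gamma>" "\<gamma> < 1" and \<Lambda>: "2 / (1 - \<gamma>) \<le> \<Lambda> / h" "N \<le> \<Lambda> / h"
  shows "\<exists>n::nat. N \<le> n \<and> 0 < real n \<and> (1 + 3 * \<gamma>) / 4 * h \<le> \<Lambda> / n \<and>
    \<Lambda> / n \<le> (3 + \<gamma>) / 4 * h \<and> n \<le> 4 * (\<Lambda> / h)"
proof -
  define X a b where "X = \<Lambda> / h" and "a = (1 + 3 * \<gamma>) / 4" and "b = (3 + \<gamma>) / 4"
  define n where "n = nat \<lceil>X / b\<rceil>"
  have ab: "1 / 4 \<le> a" "0 < a" "a < 1" "0 < b" "b < 1" "b - a = (1 - \<gamma>) / 2"
    using assms(2,3) by (auto simp: a_def b_def field_simps)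
  have "0 < 2 / (1 - \<gamma>)" using assms(3) by simp
  then have X: "0 < X" "2 / (1 - \<gamma>) \<le> X" using \<Lambda>(1) unfolding X_def by linarith+
  then have "1 \<le> X * (b - a)" using assms(3) by (simp add: ab(6) field_simps)
  moreover have "a * b \<le> 1 * 1" using ab by (intro mult_mono) auto
  ultimately have "X * a + a * b \<le> X * b" by (simp add: algebra_simps)
  then have "X / b + 1 \<le> X / a" using ab by (simp add: field_simps)
  moreover have "0 < X / b" using X ab by simp
  then have n: "X / b \<le> n" "n < X / b + 1" unfolding n_def by linarith+
  ultimately have "n \<le> X / a" "0 < n" using \<open>0 < X / b\<close> by (linarith, metis gr0I not_le of_nat_0)
  moreover have "X \<le> X / b" "X / a \<le> 4 * X"
    using X ab by (auto simp: field_simps)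
  ultimately have "N \<le> n" "0 < n" "n \<le> 4 * X"
    using n(1) \<Lambda>(2) unfolding X_def[symmetric] by linarith+
  moreover have "a * n \<le> X" "X \<le> b * n"
    using n(1) \<open>n \<le> X / a\<close> ab by (simp_all add: field_simps)
  moreover have "a * h \<le> \<Lambda> / n" "\<Lambda> / n \<le> b * h"
  proof -
    have "\<Lambda> = X * h" using assms(1) by (simp add: X_def)
    moreover have "a * n * h \<le> X * h" "X * h \<le> b * n * h"
      using \<open>a * n \<le> X\<close> \<open>X \<le> b * n\<close> assms(1) by (auto intro: mult_right_mono)
    ultimately show "a * h \<le> \<Lambda> / n" "\<Lambda> / n \<le> b * h"
      using \<open>0 < n\<close> by (simp_all add: field_simps)
  qed
  ultimately show ?thesis unfolding X_def[symmetric] a_def[symmetric] b_def[symmetric]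
    by (intro exI[of _ n] conjI; (assumption | simp))
qed

text \<open>Superlinear growth from \<open>p > 1\<close>: for \<open>\<xi> \<ge> 1\<close> the left
  side is at most \<open>(A + B) * \<xi>\<close>, and \<open>\<xi> powr (p - 1)\<close> eventually
  exceeds \<open>(A + B) / c\<close>.\<close>

lemma affine_le_powr:
  fixes A B c p :: real
  assumes "1 < p" "0 < c" "0 \<le> A" "0 \<le> B"
  shows "\<exists>X\<ge>1. \<forall>\<xi>\<ge>X. A + B * \<xi> \<le> c * \<xi> powr p"
proof (intro exI[of _ "max 1 (((A + B) / c) powr (1 / (p - 1)))"] conjI allI impI)
  fix \<xi> assume "max 1 (((A + B) / c) powr (1 / (p - 1))) \<le> \<xi>"
  then have \<xi>: "1 \<le> \<xi>" "((A + B) / c) powr (1 / (p - 1)) \<le> \<xi>" by auto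
  have "(A + B) / c = (((A + B) / c) powr (1 / (p - 1))) powr (p - 1)"
    using assms by (simp add: powr_powr)
  also have "\<dots> \<le> \<xi> powr (p - 1)" using \<xi> assms by (intro powr_mono2) auto
  finally have le: "A + B \<le> c * \<xi> powr (p - 1)" using assms by (simp add: field_simps)
  have "A * 1 + B * \<xi> \<le> A * \<xi> + B * \<xi>" using \<xi> assms by (intro add_mono mult_left_mono) auto
  also have "\<dots> = (A + B) * \<xi>" by (simp add: algebra_simps)
  also have "\<dots> \<le> c * \<xi> powr (p - 1) * \<xi>" using le \<xi> by (intro mult_right_mono) auto
  also have "\<dots> = c * \<xi> powr p" using \<xi> by (simp add: powr_diff)
  finally show "A + B * \<xi> \<le> c * \<xi> powr p" by simp
qed simp

text \<open>Open intervals of length \<open>\<eta>\<close> are placed at half steps so that they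
  overlap and no endpoint is missed. The shift by -1 makes the interval with \<open>j = 0\<close>
  start before \<open>T\<close>.\<close>

lemma half_step_cover:
  fixes \<eta> T t :: real
  assumes "0 < \<eta>" "T \<le> t" "t < T + L"
  shows "\<exists>j::nat. j \<le> 2 * L / \<eta> \<and> T + (real j - 1) * (\<eta> / 2) < t \<and> t < T + (real j - 1) * (\<eta> / 2) + \<eta>"
proof -
  define y where "y = (t - T) / (\<eta> / 2)"
  define j where "j = nat \<lfloor>y\<rfloor>"
  have t: "t = T + y * (\<eta> / 2)" using assms(1) by (simp add: y_def field_simps)
  have "0 \<le> y" using assms by (simp add: y_def)
  then have j: "real j \<le> y" "y < real j + 1" unfolding j_def by linarith+
  have "y \<le> L / (\<eta> / 2)" unfolding y_def using assms by (intro divide_right_mono) auto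
  then have "y \<le> 2 * L / \<eta>" by (simp add: mult.commute)
  moreover have "(real j - 1) * (\<eta> / 2) < y * (\<eta> / 2)"
    "y * (\<eta> / 2) < (real j + 1) * (\<eta> / 2)"
    using j assms(1) by (auto intro!: mult_strict_right_mono)
  moreover have "T + (real j - 1) * (\<eta> / 2) + \<eta> = T + (real j + 1) * (\<eta> / 2)"
    by (simp add: field_simps)
  ultimately show ?thesis using j(1) assms(1) unfolding t
    by (intro exI[of _ j] conjI) linarith+
qed

context doubling_space
begin

definition box_mass :: "('a \<times> real \<Rightarrow> real) \<Rightarrow> real \<Rightarrow> real \<Rightarrow> 'a \<Rightarrow> real \<Rightarrow> ennreal" where
  "box_mass \<omega> r \<eta> x a = (\<integral>\<^sup>+v\<in>qball \<rho> x r \<times> {a<..<a + \<eta>}. ennreal (\<omega> v) \<partial>par_measure \<mu>)"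

lemma box_mass_le_weight:
  assumes "backward_bound \<omega> \<gamma> B h R r w" "\<rho> x (fst w) < r" "r' \<le> r"
    and "snd w - h \<le> a" "a + \<eta> \<le> snd w - \<gamma> * h"
  shows "box_mass \<omega> r' \<eta> x a \<le> ennreal (B * h) * emeasure \<mu> (qball \<rho> x R) * ennreal (\<omega> w)"
proof -
  have "qball \<rho> x r' \<times> {a<..<a + \<eta>} \<subseteq> qball \<rho> x r \<times> {snd w - h<..<snd w - \<gamma> * h}"
    using assms(4,5) by (intro Sigma_mono qball_mono assms(3)) auto
  then have "box_mass \<omega> r' \<eta> x a \<le> (\<integral>\<^sup>+v\<in>qball \<rho> x r \<times> {snd w - h<..<snd w - \<gamma> * h}. ennreal (\<omega> v) \<partial>par_measure \<mu>)"
    unfolding box_mass_def by (intro nn_integral_mono) (auto split: split_indicator)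
  also have "\<dots> \<le> ennreal (B * h) * emeasure \<mu> (qball \<rho> x R) * ennreal (\<omega> w)"
    using assms(1,2) unfolding backward_bound_def by blast
  finally show ?thesis .
qed

text \<open>For a box of duration \<open>(1 - \<gamma>) / 4 * h\<close> these are the lags \<open>\<tau>\<close> for which the shifted box stays
  within the times from \<open>s - h\<close> to \<open>s - \<gamma> * h\<close> for every time \<open>s\<close> of the original one.\<close>

lemma box_mass_step:
  assumes [measurable]: "\<omega> \<in> borel_measurable (par_measure \<mu>)"
    and pos: "0 < r" "0 < h" "\<gamma> < 1" "0 < B" "0 < D"
    and bb: "AE w in par_measure \<mu>. backward_bound \<omega> \<gamma> B h R r w"
    and cmp: "emeasure \<mu> (qball \<rho> y R) \<le> ennreal D * emeasure \<mu> (qball \<rho> x (r / (2 * K0)))"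
    and xy: "\<rho> y x \<le> r / (2 * K0)"
    and lag: "(1 + 3 * \<gamma>) / 4 * h \<le> \<tau>" "\<tau> \<le> (3 + \<gamma>) / 4 * h"
  shows "box_mass \<omega> (r / (2 * K0)) ((1 - \<gamma>) / 4 * h) y (a - \<tau>)
    \<le> ennreal (4 * B * D / (1 - \<gamma>)) * box_mass \<omega> (r / (2 * K0)) ((1 - \<gamma>) / 4 * h) x a"
proof -
  define r' where "r' = r / (2 * K0)"
  define \<eta> where "\<eta> = (1 - \<gamma>) / 4 * h"
  \<comment> \<open>The last equation puts every point within \<open>r'\<close> of \<open>x\<close>
    into the ball of radius \<open>r\<close> around \<open>y\<close>, where
    \<open>backward_bound\<close> applies.\<close>
  have r': "0 < r'" "r' \<le> r" "K0 * (r' + r') = r" using pos K0_ge_1 by (auto simp: r'_def field_simps)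
  have \<eta>: "0 < \<eta>" using pos by (simp add: \<eta>_def)
  define m where "m = emeasure \<mu> (qball \<rho> x r')"
  have m: "0 < m" "m < \<infinity>" using ball_pos[of r' x] ball_finite[of r' x] r' by (auto simp: m_def)
  define E where "E = qball \<rho> x r' \<times> {a<..<a + \<eta>}"
  have E [measurable]: "E \<in> sets (par_measure \<mu>)" by (simp add: E_def ball_measurable)
  define M where "M = box_mass \<omega> r' \<eta> y (a - \<tau>)"
  have "AE w in par_measure \<mu>. w \<in> E \<longrightarrow> M \<le> ennreal (B * h * D) * m * ennreal (\<omega> w)"
    using bb
  proof (eventually_elim, intro impI)
    fix w assume bb: "backward_bound \<omega> \<gamma> B h R r w" and w: "w \<in> E"
    have "\<rho> y (fst w) \<le> K0 * (\<rho> y x + \<rho> x (fst w))" by (rule quasi_triangle)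
    also have "\<dots> < K0 * (r' + r')" using w xy K0_ge_1
      by (intro mult_strict_left_mono) (auto simp: E_def r'_def qball_def)
    finally have near: "\<rho> y (fst w) < r" using r' by simp
    have "M \<le> ennreal (B * h) * emeasure \<mu> (qball \<rho> y R) * ennreal (\<omega> w)"
      unfolding M_def using w lag \<eta>
      by (intro box_mass_le_weight[OF bb near r'(2)]) (auto simp: E_def \<eta>_def field_simps)
    also have "\<dots> \<le> ennreal (B * h) * (ennreal D * m) * ennreal (\<omega> w)"
      using cmp by (intro mult_right_mono mult_left_mono) (auto simp: m_def r'_def)
    also have "\<dots> = ennreal (B * h * D) * m * ennreal (\<omega> w)"
      using pos by (simp add: ennreal_mult mult_ac)
    finally show "M \<le> ennreal (B * h * D) * m * ennreal (\<omega> w)" .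
  qed
  \<comment> \<open>\<open>M\<close> does not depend on \<open>w\<close>, so integrating over
    \<open>E\<close> turns the bound by \<open>\<omega> w\<close> into one by the mass of the box.
    The measure of \<open>E\<close> is \<open>m * \<eta>\<close>: the factor \<open>m\<close>
    cancels, and \<open>h / \<eta> = 4 / (1 - \<gamma>)\<close> is free of the scale.\<close>
  then have "(\<integral>\<^sup>+w\<in>E. M \<partial>par_measure \<mu>) \<le>
    (\<integral>\<^sup>+w. (ennreal (B * h * D) * m) * (ennreal (\<omega> w) * indicator E w) \<partial>par_measure \<mu>)"
    by (intro nn_integral_mono_AE) (auto elim!: eventually_mono split: split_indicator simp: mult_ac)
  also have "\<dots> = ennreal (B * h * D) * m * box_mass \<omega> r' \<eta> x a"
    by (simp add: box_mass_def E_def[symmetric] nn_integral_cmult)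
  also have "(\<integral>\<^sup>+w\<in>E. M \<partial>par_measure \<mu>) = M * (m * ennreal \<eta>)"
    using E \<eta> by (simp add: nn_integral_cmult_indicator) (simp add: E_def emeasure_ball_box m_def)
  finally have "m * (M * ennreal \<eta>) \<le> m * (ennreal (B * h * D) * box_mass \<omega> r' \<eta> x a)"
    by (simp add: mult_ac)
  then have le: "M * ennreal \<eta> \<le> ennreal (B * h * D) * box_mass \<omega> r' \<eta> x a"
    using m by (simp add: ennreal_mult_le_mult_iff)
  have "M = M * ennreal \<eta> * ennreal (1 / \<eta>)"
    using \<eta> by (simp add: mult.assoc ennreal_mult[symmetric])
  also have "\<dots> \<le> ennreal (B * h * D) * box_mass \<omega> r' \<eta> x a * ennreal (1 / \<eta>)"
    using le by (rule mult_right_mono) simp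
  also have "\<dots> = ennreal (B * h * D * (1 / \<eta>)) * box_mass \<omega> r' \<eta> x a"
    using pos \<eta> by (subst (2) ennreal_mult) (simp_all add: mult_ac)
  also have "B * h * D * (1 / \<eta>) = 4 * B * D / (1 - \<gamma>)"
    using pos by (simp add: \<eta>_def field_simps)
  finally show ?thesis by (simp add: M_def r'_def \<eta>_def)
qed

text \<open>Each step moves the box to the next point and back in time by \<open>\<tau>\<close>. Its
  cost is the same factor for all points and starting times, so the cost of a chain depends only on
  its length.\<close>

lemma box_mass_chain:
  assumes \<omega>: "\<omega> \<in> borel_measurable (par_measure \<mu>)"
    and pos: "0 < r" "0 < h" "\<gamma> < 1" "0 < B" "0 < D"
    and bb: "AE w in par_measure \<mu>. backward_bound \<omega> \<gamma> B h R r w"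
    and cmp: "\<forall>x y. \<rho> x y \<le> r / (2 * K0) \<longrightarrow>
      emeasure \<mu> (qball \<rho> y R) \<le> ennreal D * emeasure \<mu> (qball \<rho> x (r / (2 * K0)))"
    and u: "\<forall>i<n. \<rho> (u i) (u (Suc i)) \<le> r / (2 * K0)"
    and lag: "(1 + 3 * \<gamma>) / 4 * h \<le> \<tau>" "\<tau> \<le> (3 + \<gamma>) / 4 * h"
  shows "box_mass \<omega> (r / (2 * K0)) ((1 - \<gamma>) / 4 * h) (u n) (a - n * \<tau>)
    \<le> ennreal ((4 * B * D / (1 - \<gamma>)) ^ n) * box_mass \<omega> (r / (2 * K0)) ((1 - \<gamma>) / 4 * h) (u 0) a"
  using u
proof (induction n)
  case (Suc n)
  let ?m = "box_mass \<omega> (r / (2 * K0)) ((1 - \<gamma>) / 4 * h)" and ?c = "4 * B * D / (1 - \<gamma>)"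
  have c: "0 < ?c" using pos by simp
  have near: "\<rho> (u n) (u (Suc n)) \<le> r / (2 * K0)" using Suc.prems by simp
  have "?m (u (Suc n)) (a - n * \<tau> - \<tau>) \<le> ennreal ?c * ?m (u n) (a - n * \<tau>)"
    using near cmp sym[of "u n"] by (intro box_mass_step[OF \<omega> pos bb _ _ lag]) auto
  also have "\<dots> \<le> ennreal ?c * (ennreal (?c ^ n) * ?m (u 0) a)"
    using Suc.IH Suc.prems by (intro mult_left_mono) auto
  also have "\<dots> = ennreal (?c ^ Suc n) * ?m (u 0) a"
    using ennreal_mult[of ?c "?c ^ n"] c by (simp only: power_Suc mult.assoc zero_le_power less_imp_le)
  finally show ?case by (simp add: algebra_simps)
qed simp

lemma average_cylinder_minus_le:
  assumes "0 < l" "\<gamma> < 1" "0 \<le> c"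
    and "(\<integral>\<^sup>+v\<in>cylinder_minus p \<rho> \<gamma> x t l. ennreal (\<omega> v) \<partial>par_measure \<mu>)
      \<le> ennreal (c * l powr p) * emeasure \<mu> (qball \<rho> x l) * ennreal y"
  shows "par_average (par_measure \<mu>) (cylinder_minus p \<rho> \<gamma> x t l) (\<lambda>z. ennreal (\<omega> z)) \<le> ennreal (c / (1 - \<gamma>) * y)"
proof -
  have lt: "t - l powr p < t - \<gamma> * l powr p"
    using mult_strict_right_mono[OF assms(2), of "l powr p"] assms(1) by simp
  have e: "emeasure (par_measure \<mu>) (cylinder_minus p \<rho> \<gamma> x t l) = emeasure \<mu> (qball \<rho> x l) * ennreal ((1 - \<gamma>) * l powr p)"
    using lt by (simp add: cylinder_minus_def emeasure_ball_box algebra_simps)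
  have "ennreal (c * l powr p) = ennreal ((1 - \<gamma>) * l powr p) * ennreal (c / (1 - \<gamma>))"
    using assms by (simp add: ennreal_mult[symmetric])
  then have "ennreal (c * l powr p) * emeasure \<mu> (qball \<rho> x l) * ennreal y =
      emeasure (par_measure \<mu>) (cylinder_minus p \<rho> \<gamma> x t l) * ennreal (c / (1 - \<gamma>) * y)"
    using ennreal_mult'[of "c / (1 - \<gamma>)" y] assms unfolding e by (simp add: mult_ac)
  then show ?thesis unfolding par_average_def using assms(4) ball_box_pos_finite[OF assms(1) lt, of x]
    by (intro divide_le_posI_ennreal) (auto simp: cylinder_minus_def)
qed

end

section \<open>Average bounds on cylinders\<close>

text \<open>As \<open>\<delta> < 1\<close>, rounding the exponent down enlarges the power, so its
  \<open>p\<close>-th power is at least 2.\<close>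

lemma one_le_eps0:
  assumes "0 < \<delta>" "\<delta> < 1" "0 < p"
  shows "1 \<le> eps0 p \<delta>"
proof -
  have "(2::real) = (2 powr (1 / p)) powr p" using assms(3) by (simp add: powr_powr)
  also have "2 powr (1 / p) = \<delta> powr (log \<delta> (2 powr (1 / p)))" using assms by simp
  also have "(\<delta> powr (log \<delta> (2 powr (1 / p)))) powr p \<le> (\<delta> powr of_int \<lfloor>log \<delta> (2 powr (1 / p))\<rfloor>) powr p"
    using assms by (intro powr_mono2 powr_mono') auto
  finally show ?thesis unfolding eps0_def by (simp add: powr_powr)
qed

context dyadic_space
begin

text \<open>Without a lag, the bound at \<open>w\<close> covers all times from
  \<open>snd w - d powr p\<close> up to \<open>snd w\<close>. A single scale \<open>d\<close>
  comparable to \<open>l\<close> with \<open>d powr p\<close> at least the full height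
  \<open>2 * l powr p\<close> therefore captures the whole lower part.\<close>

lemma A1_plus_0_average_bound:
  assumes \<omega>: "\<omega> \<in> A1_plus p \<rho> \<mu> \<delta> K I Q 0" and p: "0 < p" and \<gamma>': "0 \<le> \<gamma>'" "\<gamma>' < 1"
  shows "\<exists>C>0. \<forall>x t l. 0 < l \<longrightarrow> (AE w in par_measure \<mu>. w \<in> cylinder_plus p \<rho> \<gamma>' x t l \<longrightarrow>
      par_average (par_measure \<mu>) (cylinder_minus p \<rho> \<gamma>' x t l) (\<lambda>z. ennreal (\<omega> z)) \<le> ennreal (C * \<omega> w))"
proof -
  obtain b B where b: "1 \<le> b" and B: "0 < B" and ae: "AE w in par_measure \<mu>.
      \<forall>k r. 0 < r \<and> b * r \<le> \<delta> powi k \<longrightarrow>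
      backward_bound \<omega> 0 B ((\<delta> powi k) powr p) (b * \<delta> powi k) r w"
    using A1_plus_on_balls[OF \<omega>] by auto
  \<comment> \<open>Dividing by \<open>\<delta>\<close> offsets the loss in \<open>ex_scale\<close>:
    the scale below \<open>\<beta> * l\<close> is still at least \<open>b * l\<close>, as
    \<open>backward_bound\<close> needs, and at least \<open>2 powr (1 / p) * l\<close>, as the
    height needs.\<close>
  define \<beta> where "\<beta> = max b (2 powr (1 / p)) / \<delta>"
  have \<beta>: "b \<le> \<beta> * \<delta>" "2 powr (1 / p) \<le> \<beta> * \<delta>" "0 < \<beta>"
    using delta b by (simp_all add: \<beta>_def)
  obtain D where D: "1 \<le> D" "\<forall>x y r R. 0 < r \<and> R \<le> b * \<beta> * r \<and> \<rho> x y \<le> b * \<beta> * r \<longrightarrow>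
      emeasure \<mu> (qball \<rho> y R) \<le> ennreal D * emeasure \<mu> (qball \<rho> x r)"
    using ball_comparison[of "b * \<beta>"] by (elim exE conjE)
  define c where "c = B * \<beta> powr p * D"
  have c: "0 < c" using B \<beta> D(1) by (simp add: c_def)
  show ?thesis
  proof (intro exI[of _ "c / (1 - \<gamma>')"] conjI allI impI)
    show "0 < c / (1 - \<gamma>')" using c \<gamma>' by simp
    fix x t l assume l: "(0::real) < l"
    obtain k where k: "\<delta> powi k \<le> \<beta> * l" "\<beta> * l \<le> \<delta> powi k / \<delta>"
      using ex_scale[of "\<beta> * l"] \<beta> l by auto
    define d where "d = \<delta> powi k"
    have d: "0 < d" "d \<le> \<beta> * l" using delta k by (simp_all add: d_def)
    have "\<beta> * \<delta> * l \<le> d" using k(2) delta by (simp add: d_def pos_le_divide_eq mult_ac)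
    then have bl: "b * l \<le> d" "2 powr (1 / p) * l \<le> d"
      using mult_right_mono[OF \<beta>(1), of l] mult_right_mono[OF \<beta>(2), of l] l by linarith+
    have "2 * l powr p = (2 powr (1 / p) * l) powr p" using p l by (simp add: powr_mult powr_powr)
    also have "\<dots> \<le> d powr p" using bl l p by (intro powr_mono2) auto
    finally have h: "2 * l powr p \<le> d powr p" .
    have h2: "d powr p \<le> \<beta> powr p * l powr p"
      using powr_mono2[of p d "\<beta> * l"] p d l \<beta> by (simp add: powr_mult)
    have m: "emeasure \<mu> (qball \<rho> x (b * d)) \<le> ennreal D * emeasure \<mu> (qball \<rho> x l)"
    proof (rule D(2)[rule_format], intro conjI l)
      show "b * d \<le> b * \<beta> * l" using d b by (simp add: mult.assoc mult_left_mono)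
      show "\<rho> x x \<le> b * \<beta> * l" using eq_0_iff[of x x] b \<beta> l by simp
    qed
    show "AE w in par_measure \<mu>. w \<in> cylinder_plus p \<rho> \<gamma>' x t l \<longrightarrow>
      par_average (par_measure \<mu>) (cylinder_minus p \<rho> \<gamma>' x t l) (\<lambda>z. ennreal (\<omega> z)) \<le> ennreal (c / (1 - \<gamma>') * \<omega> w)"
      using ae
    proof (eventually_elim, intro impI)
      fix w assume *: "\<forall>k r. 0 < r \<and> b * r \<le> \<delta> powi k \<longrightarrow>
        backward_bound \<omega> 0 B ((\<delta> powi k) powr p) (b * \<delta> powi k) r w"
        and w: "w \<in> cylinder_plus p \<rho> \<gamma>' x t l"
      have "0 \<le> \<gamma>' * l powr p" using \<gamma>' by simp
      with w have near: "\<rho> x (fst w) < l" and s: "t < snd w" "snd w < t + l powr p"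
        by (auto simp: cylinder_plus_def qball_def)
      have "cylinder_minus p \<rho> \<gamma>' x t l \<subseteq> qball \<rho> x l \<times> {snd w - d powr p <..< snd w - 0 * d powr p}"
        unfolding cylinder_minus_def using s h \<open>0 \<le> \<gamma>' * l powr p\<close> by (intro Sigma_mono) auto
      then have "(\<integral>\<^sup>+v\<in>cylinder_minus p \<rho> \<gamma>' x t l. ennreal (\<omega> v) \<partial>par_measure \<mu>) \<le>
        (\<integral>\<^sup>+v\<in>qball \<rho> x l \<times> {snd w - d powr p <..< snd w - 0 * d powr p}. ennreal (\<omega> v) \<partial>par_measure \<mu>)"
        by (intro nn_integral_mono) (auto split: split_indicator)
      also have "\<dots> \<le> ennreal (B * d powr p) * emeasure \<mu> (qball \<rho> x (b * d)) * ennreal (\<omega> w)"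
        using *[rule_format, of l k] l bl(1) near unfolding backward_bound_def d_def by blast
      also have "\<dots> \<le> ennreal (B * (\<beta> powr p * l powr p)) * (ennreal D * emeasure \<mu> (qball \<rho> x l)) * ennreal (\<omega> w)"
        using m h2 B by (intro mult_right_mono mult_mono ennreal_leI) auto
      also have "\<dots> = ennreal (B * (\<beta> powr p * l powr p) * D) * emeasure \<mu> (qball \<rho> x l) * ennreal (\<omega> w)"
        using B D(1) by (subst ennreal_mult[of _ D]) (simp_all add: mult.assoc)
      also have "B * (\<beta> powr p * l powr p) * D = c * l powr p" by (simp add: c_def)
      finally show "par_average (par_measure \<mu>) (cylinder_minus p \<rho> \<gamma>' x t l) (\<lambda>z. ennreal (\<omega> z)) \<le> ennreal (c / (1 - \<gamma>') * \<omega> w)"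
        using c by (intro average_cylinder_minus_le[OF l \<gamma>'(2)]) auto
    qed
  qed
qed

text \<open>At a scale much smaller than \<open>l\<close> a geodesic across the ball has about \<open>l / d\<close> steps, whose time
  lags \<open>d powr p\<close> add up to far less than \<open>l powr p\<close>, as \<open>p > 1\<close>. So there is enough time to go from
  any point of the upper part to any small box in the lower part.\<close>

lemma A1_plus_average_bound:
  assumes \<omega>: "\<omega> \<in> A1_plus p \<rho> \<mu> \<delta> K I Q \<gamma>" and \<gamma>: "0 \<le> \<gamma>" "\<gamma> < 1" and p: "1 < p" and \<gamma>': "0 < \<gamma>'" "\<gamma>' < 1"
  shows "\<exists>C>0. \<forall>x t l. 0 < l \<longrightarrow> (AE w in par_measure \<mu>. w \<in> cylinder_plus p \<rho> \<gamma>' x t l \<longrightarrow>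
      par_average (par_measure \<mu>) (cylinder_minus p \<rho> \<gamma>' x t l) (\<lambda>z. ennreal (\<omega> z)) \<le> ennreal (C * \<omega> w))"
proof -
  have meas [measurable]: "\<omega> \<in> borel_measurable (par_measure \<mu>)"
    using \<omega> by (simp add: A1_plus_def weight_def)
  obtain b B where b: "1 \<le> b" and B: "0 < B" and ae: "AE w in par_measure \<mu>.
      \<forall>k r. 0 < r \<and> b * r \<le> \<delta> powi k \<longrightarrow>
      backward_bound \<omega> \<gamma> B ((\<delta> powi k) powr p) (b * \<delta> powi k) r w"
    using A1_plus_on_balls[OF \<omega> \<gamma>] by (elim exE conjE)
  obtain K' where K': "1 \<le> K'" "\<forall>d x y n. 0 < d \<and> 1 + K' * \<rho> x y / d \<le> real n \<longrightarrow>
      (\<exists>u. u 0 = x \<and> u n = y \<and> (\<forall>i<n. \<rho> (u i) (u (Suc i)) \<le> d))"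
    using bounded_step_chains[OF geodesic] by (elim exE conjE)
  \<comment> \<open>The ratio of the large radius \<open>b * d\<close> to the box radius
    \<open>r' = d / (2 * K0 * b)\<close>, for the comparison in each chain step.\<close>
  define A\<^sub>1 where "A\<^sub>1 = 2 * K0 * b * b"
  have "1 * 1 * 1 * 1 \<le> A\<^sub>1" unfolding A\<^sub>1_def using b K0_ge_1 by (intro mult_mono) auto
  then have A1: "1 \<le> A\<^sub>1" by simp
  obtain D\<^sub>1 where D1: "1 \<le> D\<^sub>1" "\<forall>x y r R. 0 < r \<and> R \<le> A\<^sub>1 * r \<and> \<rho> x y \<le> A\<^sub>1 * r \<longrightarrow>
      emeasure \<mu> (qball \<rho> y R) \<le> ennreal D\<^sub>1 * emeasure \<mu> (qball \<rho> x r)"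
    using ball_comparison[of A\<^sub>1] by (elim exE conjE)
  \<comment> \<open>For the last comparison, of the ball of radius \<open>b * d\<close> around the
    point of the upper part with the ball of the cylinder.\<close>
  obtain D\<^sub>2 where D2: "1 \<le> D\<^sub>2" "\<forall>x y r R. 0 < r \<and> R \<le> b * r \<and> \<rho> x y \<le> b * r \<longrightarrow>
      emeasure \<mu> (qball \<rho> y R) \<le> ennreal D\<^sub>2 * emeasure \<mu> (qball \<rho> x r)"
    using ball_comparison[of b] by (elim exE conjE)
  define q where "q = 4 * B * D\<^sub>1 / (1 - \<gamma>)"
  have q: "0 < q" using B D1(1) \<gamma> by (simp add: q_def)
  \<comment> \<open>\<open>G * (l / d)\<close> equals \<open>K' * (K0 * (l + l)) / r'\<close>, which
    bounds the steps of length \<open>r'\<close> needed between two points of the ball of radius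
    \<open>l\<close>.\<close>
  define G where "G = 4 * K0 * K0 * b * K'"
  have G: "0 \<le> G" using K0_ge_1 b K'(1) by (simp add: G_def)
  \<comment> \<open>In units of \<open>h\<close>, the time gap between the two parts of the cylinder
    is \<open>2 * \<gamma>' * \<xi> powr p\<close>. It must pay for both lower bounds in
    \<open>choose_steps\<close>; of the summand 2, one unit is the 1 in the number of steps and one
    is the time \<open>h\<close> lost in the final comparison with
    \<open>\<omega> w\<close>.\<close>
  obtain X where X: "1 \<le> X" "\<forall>\<xi>\<ge>X. (2 / (1 - \<gamma>) + 2) + G * \<xi> \<le> 2 * \<gamma>' * \<xi> powr p"
    using affine_le_powr[of p "2 * \<gamma>'" "2 / (1 - \<gamma>) + 2" G] p \<gamma> \<gamma>' G by auto
  define Y where "Y = X / \<delta>"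
  have Y: "0 < Y" using X delta by (simp add: Y_def)
  \<comment> \<open>As \<open>l \<le> Y * d\<close>, covering the ball of radius \<open>l\<close> by
    balls of radius \<open>l / A\<^sub>3\<close> uses radii of at most \<open>r'\<close>.\<close>
  define A\<^sub>3 where "A\<^sub>3 = Y * (2 * K0 * b)"
  have A3: "0 < A\<^sub>3" using Y K0_ge_1 b by (simp add: A\<^sub>3_def)
  obtain M :: nat where M: "\<forall>x r. 0 < r \<longrightarrow> (\<exists>S. finite S \<and> card S \<le> M \<and> S \<subseteq> qball \<rho> x (A\<^sub>3 * r) \<and>
      qball \<rho> x (A\<^sub>3 * r) \<subseteq> (\<Union>w\<in>S. qball \<rho> w r))"
    using finite_ball_cover[of A\<^sub>3] A3 by (auto simp: less_imp_le)
  \<comment> \<open>\<open>N\<^sub>1\<close> bounds the length of a chain, and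
    \<open>N\<^sub>2\<close> the index of a time interval of length \<open>\<eta>\<close> in
    \<open>half_step_cover\<close>. Both depend on \<open>l / d\<close> only through its bound
    \<open>Y\<close>.\<close>
  define N\<^sub>1 where "N\<^sub>1 = nat \<lfloor>4 * (2 * Y powr p + 1)\<rfloor>"
  define N\<^sub>2 where "N\<^sub>2 = nat \<lfloor>8 * Y powr p / (1 - \<gamma>)\<rfloor>"
  define N where "N = (M + 1) * (N\<^sub>2 + 1)"
  have N: "0 < N" by (simp add: N_def)
  \<comment> \<open>At most \<open>N\<close> boxes, each paying for at most \<open>N\<^sub>1\<close>
    chain steps and for the final passage to \<open>\<omega> w\<close>. The maximum with 1 allows
    chains shorter than \<open>N\<^sub>1\<close>.\<close>
  define c where "c = real N * (max 1 q ^ N\<^sub>1 * (B * D\<^sub>2))"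
  have c: "0 < c" unfolding c_def using B D2(1) N by (intro mult_pos_pos) auto
  show ?thesis
  proof (intro exI[of _ "c / (1 - \<gamma>')"] conjI allI impI)
    show "0 < c / (1 - \<gamma>')" using c \<gamma>' by simp
    fix x t l assume l: "(0::real) < l"
    obtain k where k: "\<delta> powi k \<le> l / X" "l / X \<le> \<delta> powi k / \<delta>"
      using ex_scale[of "l / X"] X l by auto
    define d where "d = \<delta> powi k"
    have d: "0 < d" using delta by (simp add: d_def)
    have X0: "0 < X" using X by simp
    have dl: "X * d \<le> l" "l \<le> Y * d"
      using k X0 delta by (simp_all add: d_def Y_def field_simps)
    have "1 * d \<le> X * d" using X d by (intro mult_right_mono) auto
    with dl have dl1: "d \<le> l" by simp
    define r where "r = d / b"
    define r' where "r' = r / (2 * K0)"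
    define h where "h = d powr p"
    define \<eta> where "\<eta> = (1 - \<gamma>) / 4 * h"
    define \<xi> where "\<xi> = l / d"
    have r: "0 < r" "b * r = d" using d b by (simp_all add: r_def)
    have r': "0 < r'" "r' \<le> r" "A\<^sub>1 * r' = b * d"
      using r b K0_ge_1 by (auto simp: r'_def A\<^sub>1_def field_simps r_def)
    have h: "0 < h" using d by (simp add: h_def)
    have \<eta>: "0 < \<eta>" "\<eta> \<le> h" using h \<gamma> by (auto simp: \<eta>_def field_simps)
    have \<xi>: "X \<le> \<xi>" "\<xi> \<le> Y" using dl d by (simp_all add: \<xi>_def field_simps)
    have lp: "l powr p = \<xi> powr p * h" using l d by (simp add: \<xi>_def h_def powr_divide)
    have \<xi>p: "\<xi> powr p \<le> Y powr p" using \<xi> X p by (intro powr_mono2) auto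
    have hl: "h \<le> l powr p" unfolding h_def using dl1 d p by (intro powr_mono2) auto
    define T where "T = t - l powr p"
    define a where "a j = T + (real j - 1) * (\<eta> / 2)" for j :: nat
    have lA: "0 < l / A\<^sub>3" "A\<^sub>3 * (l / A\<^sub>3) = l" using l A3 by simp_all
    have lr': "l / A\<^sub>3 \<le> r'"
    proof -
      have "l / A\<^sub>3 \<le> Y * d / A\<^sub>3" using dl A3 by (intro divide_right_mono) auto
      also have "\<dots> = r'" using Y b K0_ge_1 by (simp add: A\<^sub>3_def r'_def r_def)
      finally show ?thesis .
    qed
    obtain S where S: "finite S" "card S \<le> M" "S \<subseteq> qball \<rho> x l" "qball \<rho> x l \<subseteq> (\<Union>w\<in>S. qball \<rho> w (l / A\<^sub>3))"
      using M[rule_format, OF lA(1), of x] unfolding lA(2) by (elim exE conjE)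
    \<comment> \<open>Only boxes starting before the end of the lower part are kept, which
      guarantees the time gap to the upper part for each of them.\<close>
    define F where "F = S \<times> {j \<in> {..N\<^sub>2}. a j < t - \<gamma>' * l powr p}"
    have F: "finite F" using S(1) by (simp add: F_def)
    have "card {j \<in> {..N\<^sub>2}. a j < t - \<gamma>' * l powr p} \<le> card {..N\<^sub>2}" by (intro card_mono) auto
    then have cF: "card F \<le> N"
      unfolding F_def N_def card_cartesian_product using S(2) by (intro mult_mono) auto
    define E where "E = (\<lambda>(v, j). qball \<rho> v r' \<times> {a j<..<a j + \<eta>})"
    have FE: "cylinder_minus p \<rho> \<gamma>' x t l \<subseteq> (\<Union>i\<in>F. E i)"
    proof
      fix w assume w: "w \<in> cylinder_minus p \<rho> \<gamma>' x t l"
      obtain y s where ys: "w = (y, s)" by (cases w)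
      have y: "y \<in> qball \<rho> x l" and s: "T < s" "s < t - \<gamma>' * l powr p"
        using w by (auto simp: cylinder_minus_def ys T_def)
      have "0 \<le> \<gamma>' * l powr p" using \<gamma>' by simp
      then have "s < T + l powr p" using s by (simp add: T_def)
      then obtain j :: nat where j: "j \<le> 2 * l powr p / \<eta>" "a j < s" "s < a j + \<eta>"
        using half_step_cover[of \<eta> T s "l powr p"] \<eta> s by (auto simp: a_def)
      have "2 * l powr p / \<eta> = 8 * \<xi> powr p / (1 - \<gamma>)"
        using h \<gamma> by (simp add: lp \<eta>_def field_simps)
      also have "\<dots> \<le> 8 * Y powr p / (1 - \<gamma>)" using \<xi>p \<gamma> by (intro divide_right_mono) auto
      finally have "real j \<le> 8 * Y powr p / (1 - \<gamma>)" using j(1) by simp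
      then have "j \<le> N\<^sub>2" unfolding N\<^sub>2_def by linarith
      moreover obtain v where v: "v \<in> S" "y \<in> qball \<rho> v (l / A\<^sub>3)" using S(4) y by blast
      moreover have "y \<in> qball \<rho> v r'" using v(2) qball_mono[OF lr'] by blast
      ultimately have "(v, j) \<in> F" "w \<in> E (v, j)" using j s by (auto simp: F_def E_def ys)
      then show "w \<in> (\<Union>i\<in>F. E i)" by blast
    qed
    have bb: "AE w in par_measure \<mu>. backward_bound \<omega> \<gamma> B h (b * d) r w"
      using ae r by (auto elim!: eventually_mono simp: h_def d_def)
    have cmp: "\<forall>x y. \<rho> x y \<le> r' \<longrightarrow> emeasure \<mu> (qball \<rho> y (b * d)) \<le> ennreal D\<^sub>1 * emeasure \<mu> (qball \<rho> x r')"
    proof (intro allI impI D1(2)[rule_format] conjI r'(1))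
      fix x y assume "\<rho> x y \<le> r'"
      also have "r' \<le> A\<^sub>1 * r'" using A1 r'(1) by (simp add: mult_le_cancel_right1)
      finally show "\<rho> x y \<le> A\<^sub>1 * r'" .
    qed (simp add: r'(3))
    show "AE w in par_measure \<mu>. w \<in> cylinder_plus p \<rho> \<gamma>' x t l \<longrightarrow>
      par_average (par_measure \<mu>) (cylinder_minus p \<rho> \<gamma>' x t l) (\<lambda>z. ennreal (\<omega> z)) \<le> ennreal (c / (1 - \<gamma>') * \<omega> w)"
      using bb
    proof (eventually_elim, intro impI)
      fix w assume bbw: "backward_bound \<omega> \<gamma> B h (b * d) r w" and w: "w \<in> cylinder_plus p \<rho> \<gamma>' x t l"
      have near: "\<rho> x (fst w) < l" and s: "t + \<gamma>' * l powr p < snd w" "snd w < t + l powr p"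
        using w by (auto simp: cylinder_plus_def qball_def)
      define m where "m = emeasure \<mu> (qball \<rho> x l)"
      have m: "emeasure \<mu> (qball \<rho> (fst w) (b * d)) \<le> ennreal D\<^sub>2 * m"
        unfolding m_def
      proof (intro D2(2)[rule_format] conjI l)
        show "b * d \<le> b * l" using b dl1 by simp
        have "1 * l \<le> b * l" using b l by (intro mult_right_mono) auto
        then show "\<rho> x (fst w) \<le> b * l" using near by simp
      qed
      define V where "V = ennreal (max 1 q ^ N\<^sub>1) * (ennreal (B * h) * (ennreal D\<^sub>2 * m) * ennreal (\<omega> w))"
      have box: "box_mass \<omega> r' \<eta> v (a j) \<le> V" if vj: "(v, j) \<in> F" for v j
      proof -
        have v: "\<rho> x v < l" using vj S(3) by (auto simp: F_def qball_def)
        have aj: "a j < t - \<gamma>' * l powr p" using vj by (simp add: F_def)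
        \<comment> \<open>The chain starts with the box at \<open>fst w\<close> and time
          \<open>snd w - h\<close>, the earliest that \<open>backward_bound\<close> controls by
          \<open>\<omega> w\<close>. With \<open>n\<close> lags of length \<open>L / n\<close> it
          ends exactly at time \<open>a j\<close>.\<close>
        define L where "L = snd w - h - a j"
        \<comment> \<open>The extreme case is \<open>j = 0\<close>, where the box starts half a box
          length before \<open>T\<close>.\<close>
        have "- (\<eta> / 2) \<le> (real j - 1) * (\<eta> / 2)" using \<eta> by (simp add: algebra_simps)
        then have "T - \<eta> / 2 \<le> a j" by (simp add: a_def)
        then have L1: "L \<le> 2 * l powr p + h" using s \<eta> h by (simp add: L_def T_def)
        have L2: "2 * \<gamma>' * l powr p - h \<le> L" using s aj by (simp add: L_def)
        have "(2 * \<gamma>' * l powr p - h) / h \<le> L / h" using L2 h by (intro divide_right_mono) auto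
        then have "2 * \<gamma>' * \<xi> powr p - 1 \<le> L / h" using h by (simp add: lp diff_divide_distrib)
        then have Lh: "2 / (1 - \<gamma>) + 1 + G * \<xi> \<le> L / h" using X(2) \<xi>(1) by force
        have "L / h \<le> (2 * l powr p + h) / h" using L1 h by (intro divide_right_mono) auto
        then have Lh2: "L / h \<le> 2 * \<xi> powr p + 1" using h by (simp add: lp add_divide_distrib)
        have "0 \<le> G * \<xi>" "0 \<le> 2 / (1 - \<gamma>)" using G \<xi> X \<gamma> by auto
        then have lags: "2 / (1 - \<gamma>) \<le> L / h" "1 + G * \<xi> \<le> L / h" using Lh by linarith+
        obtain n :: nat where n: "1 + G * \<xi> \<le> n" "0 < real n" "(1 + 3 * \<gamma>) / 4 * h \<le> L / n"
          "L / n \<le> (3 + \<gamma>) / 4 * h" "n \<le> 4 * (L / h)"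
          using choose_steps[OF h \<gamma> lags] by (elim exE conjE)
        have "L / h \<le> 2 * Y powr p + 1" using Lh2 \<xi>p by linarith
        then have "4 * (L / h) \<le> 4 * (2 * Y powr p + 1)" by (rule mult_left_mono) simp
        with n(5) have "real n \<le> 4 * (2 * Y powr p + 1)" by (rule order.trans)
        then have nN: "n \<le> N\<^sub>1" unfolding N\<^sub>1_def by linarith
        have "\<rho> (fst w) v \<le> K0 * (\<rho> (fst w) x + \<rho> x v)" by (rule quasi_triangle)
        also have "\<dots> \<le> K0 * (l + l)" using near v sym[of x "fst w"] K0_ge_1 by (intro mult_left_mono) auto
        finally have "K' * \<rho> (fst w) v / r' \<le> K' * (K0 * (l + l)) / r'"
          using K'(1) r'(1) by (intro divide_right_mono mult_left_mono) auto
        also have "\<dots> = G * \<xi>" using b K0_ge_1 by (simp add: G_def \<xi>_def r'_def r_def)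
        finally have "1 + K' * \<rho> (fst w) v / r' \<le> n" using n(1) by simp
        then obtain u where u: "u 0 = fst w" "u n = v" "\<forall>i<n. \<rho> (u i) (u (Suc i)) \<le> r'"
          using K'(2)[rule_format, of r' "fst w" v n] r'(1) by blast
        have "box_mass \<omega> r' \<eta> (u n) (snd w - h - n * (L / n)) \<le> ennreal (q ^ n) * box_mass \<omega> r' \<eta> (u 0) (snd w - h)"
          unfolding r'_def \<eta>_def q_def using D1(1)
          by (intro box_mass_chain[OF meas r(1) h \<gamma>(2) B _ bb cmp[unfolded r'_def] u(3)[unfolded r'_def] n(3,4)]) simp
        then have "box_mass \<omega> r' \<eta> v (a j) \<le> ennreal (q ^ n) * box_mass \<omega> r' \<eta> (fst w) (snd w - h)"
          using n(2) by (simp add: u L_def)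
        also have "\<dots> \<le> ennreal (max 1 q ^ N\<^sub>1) * (ennreal (B * h) * emeasure \<mu> (qball \<rho> (fst w) (b * d)) * ennreal (\<omega> w))"
        proof (intro mult_mono ennreal_leI)
          have "q ^ n \<le> max 1 q ^ n" using q by (intro power_mono) auto
          also have "\<dots> \<le> max 1 q ^ N\<^sub>1" using nN by (intro power_increasing) auto
          finally show "q ^ n \<le> max 1 q ^ N\<^sub>1" .
          show "box_mass \<omega> r' \<eta> (fst w) (snd w - h) \<le> ennreal (B * h) * emeasure \<mu> (qball \<rho> (fst w) (b * d)) * ennreal (\<omega> w)"
          proof (rule box_mass_le_weight[OF bbw _ r'(2)])
            show "\<rho> (fst w) (fst w) < r" using eq_0_iff[of "fst w" "fst w"] r by simp
            have "\<gamma> * h \<le> h - \<eta>" using mult_right_mono[of \<gamma> 1 h] \<gamma> h by (simp add: \<eta>_def field_simps)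
            then show "snd w - h + \<eta> \<le> snd w - \<gamma> * h" by simp
          qed simp
        qed auto
        also have "\<dots> \<le> V" unfolding V_def using m by (intro mult_left_mono mult_right_mono) auto
        finally show ?thesis .
      qed
      have "(\<integral>\<^sup>+v\<in>cylinder_minus p \<rho> \<gamma>' x t l. ennreal (\<omega> v) \<partial>par_measure \<mu>) \<le> of_nat (card F) * V"
      proof (rule nn_integral_le_finite_cover[OF F FE])
        fix i assume "i \<in> F"
        then show "(\<integral>\<^sup>+v\<in>E i. ennreal (\<omega> v) \<partial>par_measure \<mu>) \<le> V"
          using box[of "fst i" "snd i"] by (simp add: box_mass_def E_def split_beta)
      qed (simp_all add: E_def split_beta ball_measurable)
      also have "\<dots> \<le> of_nat N * V" using cF by (intro mult_right_mono of_nat_mono) auto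
      also have "\<dots> = ennreal (c * h) * m * ennreal (\<omega> w)"
      proof -
        have nonneg: "0 \<le> real N" "0 \<le> max 1 q ^ N\<^sub>1" "0 \<le> B" "0 \<le> D\<^sub>2" "0 \<le> h" using B D2(1) h by auto
        have "ennreal (c * h) = of_nat N * (ennreal (max 1 q ^ N\<^sub>1) * (ennreal B * ennreal D\<^sub>2)) * ennreal h"
          unfolding c_def ennreal_of_nat_eq_real_of_nat
          using nonneg by (simp only: ennreal_mult mult_nonneg_nonneg)
        moreover have "ennreal (B * h) = ennreal B * ennreal h" using nonneg by (simp only: ennreal_mult)
        ultimately show ?thesis by (simp only: V_def mult_ac)
      qed
      also have "\<dots> \<le> ennreal (c * l powr p) * m * ennreal (\<omega> w)"
        using hl c by (intro mult_right_mono ennreal_leI mult_left_mono) auto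
      finally show "par_average (par_measure \<mu>) (cylinder_minus p \<rho> \<gamma>' x t l) (\<lambda>z. ennreal (\<omega> z)) \<le> ennreal (c / (1 - \<gamma>') * \<omega> w)"
        using c unfolding m_def by (intro average_cylinder_minus_le[OF l \<gamma>'(2)]) auto
    qed
  qed
qed

end

section \<open>The two inclusions\<close>

theorem proposition7p4:
  fixes \<rho> :: "'a \<Rightarrow> 'a \<Rightarrow> real" and \<mu> :: "'a measure"
    and K0 C\<^sub>\<mu> p \<delta> c\<^sub>0 C\<^sub>0 \<gamma> :: real and K :: nat
    and I :: "int \<Rightarrow> nat \<Rightarrow> 'i set" and z :: "int \<Rightarrow> nat \<Rightarrow> 'i \<Rightarrow> 'a"
    and Q :: "int \<Rightarrow> nat \<Rightarrow> 'i \<Rightarrow> 'a set"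
  assumes "homogeneous_type \<rho> K0 \<mu> C\<^sub>\<mu>"
    and "basic_assumptions \<rho> \<mu>"
    and "monotone_geodesic \<rho>"
    and "1 < p"
    and "basic_assumptions (par_dist p \<rho>) (par_measure \<mu>)"
    and "adjacent_dyadic_systems \<rho> K0 \<mu> \<delta> c\<^sub>0 C\<^sub>0 K I z Q"
    and "0 \<le> \<gamma>" and "\<gamma> < 1 / eps0 p \<delta>"
  shows "(\<gamma> = 0 \<longrightarrow> (\<forall>q>1. \<forall>\<gamma>'\<in>{0..<1}.
           A1_plus p \<rho> \<mu> \<delta> K I Q 0 \<subseteq> A_plus p \<rho> \<mu> q \<gamma>')) \<and>
         (\<gamma> \<noteq> 0 \<longrightarrow> (\<forall>q>1. \<forall>\<gamma>'\<in>{0<..<1}.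
           A1_plus p \<rho> \<mu> \<delta> K I Q \<gamma> \<subseteq> A_plus p \<rho> \<mu> q \<gamma>'))"
proof -
  interpret dyadic_space \<rho> K0 \<mu> C\<^sub>\<mu> \<delta> c\<^sub>0 C\<^sub>0 K I z Q
    using assms(1,2,3,6)
    by (simp add: dyadic_space_def dyadic_space_axioms_def doubling_space_def)
  have p: "0 < p" using assms(4) by simp
  \<comment> \<open>This turns the hypothesis on \<open>\<gamma>\<close> into
    \<open>\<gamma> < 1\<close>, so that the lower parts of the rectangles are nonempty.\<close>
  have "1 \<le> eps0 p \<delta>" using one_le_eps0[OF delta(1,2) p] .
  then have "1 / eps0 p \<delta> \<le> 1" by simp
  with assms(8) have \<gamma>: "\<gamma> < 1" by linarith
  have w: "weight p \<rho> \<mu> \<omega>" if "\<omega> \<in> A1_plus p \<rho> \<mu> \<delta> K I Q \<gamma>''" for \<omega> \<gamma>''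
    using that by (simp add: A1_plus_def)
  show ?thesis
  proof (intro conjI impI allI ballI subsetI)
    fix q \<gamma>' :: real and \<omega>
    assume q: "1 < q" and \<gamma>': "\<gamma>' \<in> {0..<1}" and \<omega>: "\<omega> \<in> A1_plus p \<rho> \<mu> \<delta> K I Q 0"
    then have *: "0 \<le> \<gamma>'" "\<gamma>' < 1" by auto
    show "\<omega> \<in> A_plus p \<rho> \<mu> q \<gamma>'"
      by (rule exE[OF A1_plus_0_average_bound[OF \<omega> p *]], elim conjE)
        (rule A_plus_criterion[OF w[OF \<omega>] q *])
  next
    fix q \<gamma>' :: real and \<omega>
    assume q: "1 < q" and \<gamma>': "\<gamma>' \<in> {0<..<1}" and \<omega>: "\<omega> \<in> A1_plus p \<rho> \<mu> \<delta> K I Q \<gamma>"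
    then have *: "0 < \<gamma>'" "\<gamma>' < 1" by auto
    show "\<omega> \<in> A_plus p \<rho> \<mu> q \<gamma>'"
      by (rule exE[OF A1_plus_average_bound[OF \<omega> assms(7) \<gamma> assms(4) *]], elim conjE)
        (rule A_plus_criterion[OF w[OF \<omega>] q less_imp_le[OF *(1)] *(2)])
  qed
qed

end
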